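(* Let $U$ be a sunshine graph and $T$ a caterpillar of order $n$ with $b(U,T)\ge 5$, and let $U^+$ be a sunshine supercard of $U$ and $T$ (with $w,v$, labelling and $\chi$ as in the context) chosen so that $\chi(U^+)$ is largest possible among all sunshine supercards of $U$ and $T$. Suppose that $\mathrm{Aut}(U^+)$ contains a non-trivial rotation, and let $\delta,\phi,\Phi$ be as in the context. Consider the (not necessarily disjoint) cases: (i) $\{\lambda(x_\nu):\lambda\in\mathrm{Aut}(U^+)\text{ a reflection}\}\subseteq\Phi(x_\nu)$; (ii) $d_{U^+}(x_0)=3$ and $\{\lambda(x_0):\lambda\in\mathrm{Aut}(U^+)\text{ a reflection}\}\subseteq\Phi(x_0)$. Then (a) if case (i) or case (ii) holds, there exists a $U^+$-optimum saturating set $X$ such that $X\cap\mathrm{Aut}(U^+)=\Phi$, which is isomorphic to the cyclic group of order $\frac{c}{\delta}$; (b) if neither case holds, there exist a reflection $\pi\in\mathrm{Aut}(U^+)$ and a $U^+$-optimum saturating set $X$ such that $X\cap\mathrm{Aut}(U^+)=\Phi\cup\Phi\pi$, which is isomorphic to the dihedral group of order $\frac{2c}{\delta}$.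
   Context: All graphs are finite and simple. The deck of $G$ is the multiset of unlabelled cards $G-v$; $b(G,H)$ is the cardinality of the multiset intersection of the decks. The skeleton of a graph is obtained by deleting all vertices of degree $0$ or $1$; sunshine graph: connected, skeleton a cycle; caterpillar: connected, skeleton a path. A supercard of $U$ and $T$ is a graph of order $n+1$ whose deck contains cards isomorphic to $U$ and to $T$. For a sunshine supercard $U^+$, fix $w,v$ with $U^+-w\cong U$, $U^+-v\cong T$ ($w$ a leaf, $v$ a degree-2 cycle vertex); identify $U=U^+-w$, $T=U^+-v$. Label the cycle $x_0\ldots x_{c-1}x_0$ (indices are integers taken mod $c$) with $x_0$ adjacent to $w$, $v=x_\nu$, $d_{U^+}(x_{\nu-1})\ge d_{U^+}(x_{\nu+1})$; the leaves adjacent to $x_i$ are labelled $x_i^j$, $1\le j\le d_{U^+}(x_i)-2$, with $w=x_0^1$. Write $\lambda(G)=H$ if the bijection $\lambda$ is an isomorphism from $G$ onto $H$. $B_{vw}(U^+)=\{\lambda\in\mathrm{Sym}(V(U^+)):\lambda(U-\lambda^{-1}(v))=T-\lambda(w)\}$, $B_U=\{\lambda\in B_{vw}(U^+):\lambda(U)=U^+-\lambda(w)\}$. A maximum saturating set is $X\subseteq B_{vw}(U^+)$ with: the identity in $X$; distinct $\lambda,\pi\in X$ have $\lambda^{-1}(v)\ne\pi^{-1}(v)$ and $\lambda(w)\ne\pi(w)$; and no $\sigma\in B_{vw}(U^+)\setminus X$ can be added keeping the previous property. $\chi(U^+)=\max|X\cap B_U|$ over maximum saturating sets; $X$ is $U^+$-optimum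 if $|X\cap B_U|=\chi(U^+)$. Every automorphism of $U^+$ maps the cycle to itself; it is a rotation if $\lambda(x_i)=x_{\alpha+i}$ for all $i$, a reflection if $\lambda(x_i)=x_{\alpha-i}$ for all $i$; a rotation is non-trivial if $\lambda(x_0)\ne x_0$. Let $\delta$ be the smallest positive integer $\beta$ such that $x_\beta=\lambda(x_0)$ for some rotation $\lambda\in\mathrm{Aut}(U^+)$; let $\phi\in\mathrm{Aut}(U^+)$ be the rotation with $\phi(x_i)=x_{\delta+i}$ and $\phi(x_i^j)=x_{\delta+i}^j$ for all $i,j$ (it exists and has order $c/\delta$); $\Phi=\{\phi^k:0\le k<c/\delta\}$; for a vertex $u$, $\Phi(u)=\{\lambda(u):\lambda\in\Phi\}$; $\Phi\pi=\{\lambda\pi:\lambda\in\Phi\}$. *)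

theory Defs
  imports
    "HOL-Library.Multiset"
    "HOL-Combinatorics.Permutations"
    "HOL-Algebra.Elementary_Groups"
begin

section \<open>Finite simple graphs\<close>

record 'a sgraph =
  verts :: "'a set"
  edges :: "'a set set"

definition simple_graph :: "'a sgraph \<Rightarrow> bool" where
  "simple_graph G \<longleftrightarrow> finite (verts G) \<and> (\<forall>e \<in> edges G. e \<subseteq> verts G \<and> card e = 2)"

definition order_of :: "'a sgraph \<Rightarrow> nat" where
  "order_of G = card (verts G)"

definition degree :: "'a sgraph \<Rightarrow> 'a \<Rightarrow> nat" where
  "degree G u = card {e \<in> edges G. u \<in> e}"

definition del_verts :: "'a sgraph \<Rightarrow> 'a set \<Rightarrow> 'a sgraph" where
  "del_verts G S = \<lparr>verts = verts G - S, edges = {e \<in> edges G. e \<inter> S = {}}\<rparr>"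

abbreviation del_vert :: "'a sgraph \<Rightarrow> 'a \<Rightarrow> 'a sgraph"  (infixl "-\<^sub>v" 65) where
  "G -\<^sub>v u \<equiv> del_verts G {u}"

text \<open>\<open>iso_onto f G H\<close> renders the notation \<open>f(G) = H\<close>; only the values of \<open>f\<close> on the
  vertices of \<open>G\<close> matter.\<close>

definition iso_onto :: "('a \<Rightarrow> 'b) \<Rightarrow> 'a sgraph \<Rightarrow> 'b sgraph \<Rightarrow> bool" where
  "iso_onto f G H \<longleftrightarrow> bij_betw f (verts G) (verts H) \<and>
     (\<forall>a \<in> verts G. \<forall>b \<in> verts G. {a, b} \<in> edges G \<longleftrightarrow> {f a, f b} \<in> edges H)"

definition isomorphic :: "'a sgraph \<Rightarrow> 'b sgraph \<Rightarrow> bool" where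
  "isomorphic G H \<longleftrightarrow> (\<exists>f. iso_onto f G H)"

definition connected_graph :: "'a sgraph \<Rightarrow> bool" where
  "connected_graph G \<longleftrightarrow> verts G \<noteq> {} \<and>
     (\<forall>a \<in> verts G. \<forall>b \<in> verts G. (a, b) \<in> {(p, q). {p, q} \<in> edges G}\<^sup>*)"

definition path_graph :: "nat \<Rightarrow> nat sgraph" where
  "path_graph k = \<lparr>verts = {..<k}, edges = {{i, i + 1} | i. i + 1 < k}\<rparr>"

definition cycle_graph :: "nat \<Rightarrow> nat sgraph" where
  "cycle_graph c = \<lparr>verts = {..<c}, edges = {{i, (i + 1) mod c} | i. i < c}\<rparr>"

text \<open>A single vertex counts as a path, so that stars are caterpillars.\<close>

definition is_path :: "'a sgraph \<Rightarrow> bool" where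
  "is_path G \<longleftrightarrow> (\<exists>k \<ge> 1. isomorphic G (path_graph k))"

definition is_cycle :: "'a sgraph \<Rightarrow> bool" where
  "is_cycle G \<longleftrightarrow> (\<exists>c \<ge> 3. isomorphic G (cycle_graph c))"

definition skeleton :: "'a sgraph \<Rightarrow> 'a sgraph" where
  "skeleton G = del_verts G {u \<in> verts G. degree G u \<le> 1}"

definition sunshine :: "'a sgraph \<Rightarrow> bool" where
  "sunshine G \<longleftrightarrow> simple_graph G \<and> connected_graph G \<and> is_cycle (skeleton G)"

definition caterpillar :: "'a sgraph \<Rightarrow> bool" where
  "caterpillar G \<longleftrightarrow> simple_graph G \<and> connected_graph G \<and> is_path (skeleton G)"

section \<open>Decks and supercards\<close>

text \<open>The isomorphism class of a finite graph, represented by all its copies with vertices in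
  \<^typ>\<open>nat\<close>, so that graphs over different vertex types can be compared.\<close>

definition unlabelled :: "'a sgraph \<Rightarrow> nat sgraph set" where
  "unlabelled G = {H. simple_graph H \<and> isomorphic G H}"

definition deck :: "'a sgraph \<Rightarrow> nat sgraph set multiset" where
  "deck G = image_mset (\<lambda>u. unlabelled (G -\<^sub>v u)) (mset_set (verts G))"

definition common_cards :: "'a sgraph \<Rightarrow> 'b sgraph \<Rightarrow> nat" where
  "common_cards G H = size (deck G \<inter># deck H)"

definition supercard :: "'a sgraph \<Rightarrow> 'b sgraph \<Rightarrow> nat \<Rightarrow> 'c sgraph \<Rightarrow> bool" where
  "supercard U T n G \<longleftrightarrow> simple_graph G \<and> order_of G = n + 1 \<and>
     (\<exists>w \<in> verts G. isomorphic (G -\<^sub>v w) U) \<and> (\<exists>v \<in> verts G. isomorphic (G -\<^sub>v v) T)"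

definition sunshine_supercard :: "'a sgraph \<Rightarrow> 'b sgraph \<Rightarrow> nat \<Rightarrow> 'c sgraph \<Rightarrow> bool" where
  "sunshine_supercard U T n G \<longleftrightarrow> sunshine G \<and> supercard U T n G"

text \<open>Admissible choices of the vertices \<open>w\<close> and \<open>v\<close> of a sunshine supercard; the vertices on
  the cycle of \<open>G\<close> are those of its skeleton.\<close>

definition marked_by :: "'a sgraph \<Rightarrow> 'b sgraph \<Rightarrow> 'c sgraph \<Rightarrow> 'c \<Rightarrow> 'c \<Rightarrow> bool" where
  "marked_by U T G w v \<longleftrightarrow>
     w \<in> verts G \<and> degree G w = 1 \<and> isomorphic (G -\<^sub>v w) U \<and>
     v \<in> verts (skeleton G) \<and> degree G v = 2 \<and> isomorphic (G -\<^sub>v v) T"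

section \<open>Saturating sets\<close>

text \<open>In this section \<open>G\<close> is a sunshine supercard marked by \<open>w\<close> and \<open>v\<close>, and the two graphs
  it is a supercard of are identified with \<open>G -\<^sub>v w\<close> and \<open>G -\<^sub>v v\<close>. The symmetric group on the
  vertices consists of the permutations of the whole type that fix everything else. A permutation
  mapping \<open>w\<close> to \<open>v\<close> is never in \<open>B_vw\<close>: the deletions of \<open>inv f v\<close> and \<open>f w\<close> then have no
  effect, and \<open>G -\<^sub>v w\<close> contains a cycle while \<open>G -\<^sub>v v\<close> does not.\<close>

definition B_vw :: "'a sgraph \<Rightarrow> 'a \<Rightarrow> 'a \<Rightarrow> ('a \<Rightarrow> 'a) set" where
  "B_vw G w v = {f. f permutes verts G \<and> iso_onto f (G -\<^sub>v w -\<^sub>v inv_into UNIV f v) (G -\<^sub>v v -\<^sub>v f w)}"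

definition B_U :: "'a sgraph \<Rightarrow> 'a \<Rightarrow> 'a \<Rightarrow> ('a \<Rightarrow> 'a) set" where
  "B_U G w v = {f \<in> B_vw G w v. iso_onto f (G -\<^sub>v w) (G -\<^sub>v f w)}"

definition separated :: "'a \<Rightarrow> 'a \<Rightarrow> ('a \<Rightarrow> 'a) set \<Rightarrow> bool" where
  "separated w v X \<longleftrightarrow> (\<forall>f \<in> X. \<forall>g \<in> X. f \<noteq> g \<longrightarrow> inv_into UNIV f v \<noteq> inv_into UNIV g v \<and> f w \<noteq> g w)"

definition max_saturating :: "'a sgraph \<Rightarrow> 'a \<Rightarrow> 'a \<Rightarrow> ('a \<Rightarrow> 'a) set \<Rightarrow> bool" where
  "max_saturating G w v X \<longleftrightarrow> X \<subseteq> B_vw G w v \<and> id \<in> X \<and> separated w v X \<and>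
     (\<forall>s \<in> B_vw G w v - X. \<not> separated w v (insert s X))"

definition chi :: "'a sgraph \<Rightarrow> 'a \<Rightarrow> 'a \<Rightarrow> nat" where
  "chi G w v = Max {card (X \<inter> B_U G w v) | X. max_saturating G w v X}"

definition optimum_saturating :: "'a sgraph \<Rightarrow> 'a \<Rightarrow> 'a \<Rightarrow> ('a \<Rightarrow> 'a) set \<Rightarrow> bool" where
  "optimum_saturating G w v X \<longleftrightarrow> max_saturating G w v X \<and> card (X \<inter> B_U G w v) = chi G w v"

section \<open>Labelling, rotations and reflections\<close>

text \<open>Indices modulo \<open>c\<close> are rendered by \<open>c\<close>-periodic functions on the integers; \<open>l i j\<close> is the
  leaf \<open>x\<^sub>i\<^sup>j\<close>, meaningful for \<open>1 \<le> j \<le> degree G (x i) - 2\<close> only.\<close>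

definition labelling ::
  "'a sgraph \<Rightarrow> 'a \<Rightarrow> 'a \<Rightarrow> nat \<Rightarrow> (int \<Rightarrow> 'a) \<Rightarrow> (int \<Rightarrow> nat \<Rightarrow> 'a) \<Rightarrow> int \<Rightarrow> bool" where
  "labelling G w v c x l \<nu> \<longleftrightarrow>
     (\<forall>i. x (i + int c) = x i) \<and>
     bij_betw x {0..<int c} (verts (skeleton G)) \<and>
     edges (skeleton G) = {{x i, x (i + 1)} | i. True} \<and>
     (\<forall>i. l (i + int c) = l i) \<and>
     (\<forall>i. bij_betw (l i) {1..degree G (x i) - 2}
            {u \<in> verts G. degree G u = 1 \<and> {x i, u} \<in> edges G}) \<and>
     {x 0, w} \<in> edges G \<and> w = l 0 1 \<and> v = x \<nu> \<and>
     degree G (x (\<nu> - 1)) \<ge> degree G (x (\<nu> + 1))"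

definition Aut :: "'a sgraph \<Rightarrow> ('a \<Rightarrow> 'a) set" where
  "Aut G = {f. f permutes verts G \<and> iso_onto f G G}"

definition rotations :: "'a sgraph \<Rightarrow> (int \<Rightarrow> 'a) \<Rightarrow> ('a \<Rightarrow> 'a) set" where
  "rotations G x = {f \<in> Aut G. \<exists>\<alpha>. \<forall>i. f (x i) = x (\<alpha> + i)}"

definition reflections :: "'a sgraph \<Rightarrow> (int \<Rightarrow> 'a) \<Rightarrow> ('a \<Rightarrow> 'a) set" where
  "reflections G x = {f \<in> Aut G. \<exists>\<alpha>. \<forall>i. f (x i) = x (\<alpha> - i)}"

definition rot_step :: "'a sgraph \<Rightarrow> (int \<Rightarrow> 'a) \<Rightarrow> nat" where
  "rot_step G x = (LEAST \<beta>. 0 < \<beta> \<and> (\<exists>f \<in> rotations G x. x (int \<beta>) = f (x 0)))"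

definition label_rotation ::
  "'a sgraph \<Rightarrow> (int \<Rightarrow> 'a) \<Rightarrow> (int \<Rightarrow> nat \<Rightarrow> 'a) \<Rightarrow> nat \<Rightarrow> ('a \<Rightarrow> 'a) \<Rightarrow> bool" where
  "label_rotation G x l \<delta> \<phi> \<longleftrightarrow> \<phi> \<in> Aut G \<and> (\<forall>i. \<phi> (x i) = x (int \<delta> + i)) \<and>
     (\<forall>i. \<forall>j \<in> {1..degree G (x i) - 2}. \<phi> (l i j) = l (int \<delta> + i) j)"

definition orb :: "('a \<Rightarrow> 'a) set \<Rightarrow> 'a \<Rightarrow> 'a set" where
  "orb \<Phi> u = {f u | f. f \<in> \<Phi>}"

section \<open>Groups\<close>

definition perm_group :: "('a \<Rightarrow> 'a) set \<Rightarrow> ('a \<Rightarrow> 'a) monoid" where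
  "perm_group S = \<lparr>carrier = S, mult = (\<circ>), one = id\<rparr>"

text \<open>The dihedral group of order \<open>2m\<close> for \<open>m \<ge> 1\<close>: the pair \<open>(a, e)\<close> stands for \<open>r\<^sup>a s\<^sup>e\<close>,
  where \<open>r\<^sup>m = s\<^sup>2 = 1\<close> and \<open>s r s = r\<^sup>-\<^sup>1\<close>.\<close>

definition dihedral_group :: "nat \<Rightarrow> (int \<times> bool) monoid" where
  "dihedral_group m =
     \<lparr>carrier = {0..<int m} \<times> UNIV,
      mult = (\<lambda>(a, e) (b, f). ((if e then a - b else a + b) mod int m, e \<noteq> f)),
      one = (0, False)\<rparr>"

lemma order_dihedral_group: "order (dihedral_group m) = 2 * m"
  by (simp add: order_def dihedral_group_def card_cartesian_product)

lemma group_dihedral_group: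
  assumes "m > 0"
  shows "group (dihedral_group m)"
proof (rule groupI)
  fix p q r
  assume "p \<in> carrier (dihedral_group m)" "q \<in> carrier (dihedral_group m)"
    "r \<in> carrier (dihedral_group m)"
  then show "p \<otimes>\<^bsub>dihedral_group m\<^esub> q \<otimes>\<^bsub>dihedral_group m\<^esub> r =
      p \<otimes>\<^bsub>dihedral_group m\<^esub> (q \<otimes>\<^bsub>dihedral_group m\<^esub> r)"
    by (auto simp: dihedral_group_def mod_simps algebra_simps split: prod.splits)
next
  fix p
  assume p: "p \<in> carrier (dihedral_group m)"
  obtain a e where [simp]: "p = (a, e)"
    by (cases p)
  show "\<exists>q \<in> carrier (dihedral_group m). q \<otimes>\<^bsub>dihedral_group m\<^esub> p = \<one>\<^bsub>dihedral_group m\<^esub>"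
    using p assms
    by (intro bexI[of _ "((if e then a else - a) mod int m, e)"])
       (auto simp: dihedral_group_def mod_simps)
qed (use assms in \<open>auto simp: dihedral_group_def\<close>)

end

theory Submission
  imports Defs
begin

text \<open>A non-trivial rotation makes the degrees along the cycle periodic with a period \<open>\<delta> < c\<close>, and
  this forces every element of \<open>B_U\<close> to be an automorphism. Hence \<open>\<chi>\<close> is the largest size of a
  separated set of automorphisms containing the identity, and every separated set attaining it
  extends to an optimum saturating set.

  For a rotation \<open>f\<close> the vertex \<open>f\<^sup>-\<^sup>1 v\<close> lies in \<open>\<Phi>(v)\<close>, and for a reflection it equals \<open>f v\<close>; the
  latter vertices form a second orbit of \<open>\<Phi>\<close>, of the same size. In case (i) the two orbits agree,
  and in case (ii) \<open>f w\<close> always lies in \<open>\<Phi>(w)\<close>; so at most \<open>c/\<delta>\<close> automorphisms can be separated,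
  and \<open>\<Phi>\<close> attains the bound. Otherwise the bound is \<open>2c/\<delta>\<close>, and \<open>\<Phi> \<union> \<Phi>\<pi>\<close> attains it for a suitable
  involutive reflection \<open>\<pi>\<close>.\<close>

text \<open>Indices on the cycle stay unreduced integers. Congruent ones are compared by
  divisibility of their difference, and this moves periodic functions between them.\<close>

lemma periodic_dvd:
  fixes f :: "int \<Rightarrow> 'a"
  assumes "\<And>i. f (i + n) = f i" "n dvd i - j"
  shows "f i = f j"
proof -
  have shift: "f (i + int k * n) = f i" for i k
  proof (induction k)
    case (Suc k)
    then show ?case using assms(1)[of "i + int k * n"] by (simp add: algebra_simps)
  qed simp
  obtain q where q: "i - j = n * q" using assms(2) by (auto simp: dvd_def)
  show ?thesis
  proof (cases "q \<ge> 0")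
    case True
    then have "i = j + int (nat q) * n" using q by (simp add: algebra_simps)
    then show ?thesis using shift by metis
  next
    case False
    then have "j = i + int (nat (- q)) * n" using q by (simp add: algebra_simps)
    then show ?thesis using shift by metis
  qed
qed

section \<open>Degrees, vertex deletion and isomorphisms\<close>

text \<open>Degrees are computed through neighbours because a deletion is then a set difference and
  an isomorphism acts by taking images.\<close>

definition nbrs :: "'a sgraph \<Rightarrow> 'a \<Rightarrow> 'a set" where
  "nbrs G u = {b. {u, b} \<in> edges G}"

lemma simple_graph_edge:
  assumes "simple_graph G" "{a, b} \<in> edges G"
  shows "a \<in> verts G" "b \<in> verts G" "a \<noteq> b"
  using assms by (auto simp: simple_graph_def)

lemma nbrs_subset: "simple_graph G \<Longrightarrow> nbrs G u \<subseteq> verts G"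
  by (auto simp: nbrs_def dest: simple_graph_edge)

lemma finite_nbrs: "simple_graph G \<Longrightarrow> finite (nbrs G u)"
  using nbrs_subset finite_subset by (metis simple_graph_def)

lemma degree_eq_card_nbrs:
  assumes "simple_graph G"
  shows "degree G u = card (nbrs G u)"
proof -
  have "{e \<in> edges G. u \<in> e} = (\<lambda>b. {u, b}) ` nbrs G u"
  proof (intro subset_antisym subsetI)
    fix e assume e: "e \<in> {e \<in> edges G. u \<in> e}"
    then have "card e = 2" using assms by (auto simp: simple_graph_def)
    then obtain b where "e = {u, b}" using e by (auto simp: card_2_iff)
    then show "e \<in> (\<lambda>b. {u, b}) ` nbrs G u" using e by (auto simp: nbrs_def)
  qed (auto simp: nbrs_def)
  moreover have "inj_on (\<lambda>b. {u, b}) (nbrs G u)"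
    by (auto simp: inj_on_def doubleton_eq_iff)
  ultimately show ?thesis by (simp add: degree_def card_image)
qed

lemma simple_graph_del_verts: "simple_graph G \<Longrightarrow> simple_graph (del_verts G S)"
  by (auto simp: simple_graph_def del_verts_def)

lemma nbrs_del_verts: "u \<notin> S \<Longrightarrow> nbrs (del_verts G S) u = nbrs G u - S"
  by (auto simp: nbrs_def del_verts_def)

lemma degree_del_vert:
  assumes "simple_graph G" "u \<noteq> z"
  shows "degree (G -\<^sub>v z) u = (if {u, z} \<in> edges G then degree G u - 1 else degree G u)"
  using assms
  by (auto simp: degree_eq_card_nbrs simple_graph_del_verts nbrs_del_verts)
     (auto simp: nbrs_def)

lemma degree_del_vert_le: "simple_graph G \<Longrightarrow> u \<noteq> z \<Longrightarrow> degree (G -\<^sub>v z) u \<le> degree G u"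
  by (simp add: degree_del_vert)

lemma degree_iso_onto:
  assumes "iso_onto f G H" "simple_graph G" "simple_graph H" "u \<in> verts G"
  shows "degree H (f u) = degree G u"
proof -
  have bij: "bij_betw f (verts G) (verts H)" using assms(1) by (simp add: iso_onto_def)
  have ed: "{a, b} \<in> edges G \<longleftrightarrow> {f a, f b} \<in> edges H" if "a \<in> verts G" "b \<in> verts G" for a b
    using assms(1) that by (simp add: iso_onto_def)
  have "nbrs H (f u) = f ` nbrs G u"
  proof (intro subset_antisym subsetI)
    fix y assume y: "y \<in> nbrs H (f u)"
    then have "y \<in> verts H" using nbrs_subset[OF assms(3)] by blast
    then obtain b where "b \<in> verts G" "y = f b" using bij by (auto simp: bij_betw_def)
    then show "y \<in> f ` nbrs G u" using y ed assms(4) by (auto simp: nbrs_def)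
  next
    fix y assume "y \<in> f ` nbrs G u"
    then show "y \<in> nbrs H (f u)" using ed assms(2,4) nbrs_subset[OF assms(2)]
      by (auto simp: nbrs_def)
  qed
  moreover have "inj_on f (nbrs G u)"
    using bij nbrs_subset[OF assms(2)] by (meson bij_betw_def inj_on_subset)
  ultimately show ?thesis using assms by (simp add: degree_eq_card_nbrs card_image)
qed

text \<open>Injectivity on the whole type covers a \<open>z\<close> outside \<open>G\<close>: then
  \<open>f z\<close> lies outside \<open>H\<close>, and neither deletion removes a vertex.\<close>

lemma iso_onto_del_vert:
  assumes "iso_onto f G H" "inj f"
  shows "iso_onto f (G -\<^sub>v z) (H -\<^sub>v f z)"
proof -
  have "bij_betw f (verts G - {z}) (verts H - {f z})"
    using assms by (auto simp: iso_onto_def bij_betw_def inj_on_def)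
  moreover have "{a, b} \<inter> {z} = {} \<longleftrightarrow> {f a, f b} \<inter> {f z} = {}" for a b
    using assms(2) by (auto simp: inj_def)
  ultimately show ?thesis using assms(1) by (auto simp: iso_onto_def del_verts_def)
qed

lemma Aut_id: "id \<in> Aut G"
  by (simp add: Aut_def iso_onto_def permutes_id)

lemma Aut_comp: "f \<in> Aut G \<Longrightarrow> g \<in> Aut G \<Longrightarrow> f \<circ> g \<in> Aut G"
  by (auto simp: Aut_def iso_onto_def permutes_compose intro: bij_betw_trans)
     (metis permutes_in_image)+

lemma Aut_funpow: "f \<in> Aut G \<Longrightarrow> f ^^ k \<in> Aut G"
  by (induction k) (simp_all add: Aut_id[unfolded id_def] Aut_id Aut_comp)

lemma Aut_edge: "f \<in> Aut G \<Longrightarrow> simple_graph G \<Longrightarrow> {a, b} \<in> edges G \<Longrightarrow> {f a, f b} \<in> edges G"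
  using simple_graph_edge[of G a b] by (simp add: Aut_def iso_onto_def)

lemma Aut_degree:
  assumes "f \<in> Aut G" "simple_graph G"
  shows "degree G (f u) = degree G u"
proof (cases "u \<in> verts G")
  case True
  then show ?thesis using assms degree_iso_onto by (auto simp: Aut_def)
next
  case False
  then have "f u = u" using assms by (auto simp: Aut_def permutes_def)
  then show ?thesis by simp
qed

text \<open>An automorphism survives deleting \<open>w\<close> against \<open>f w\<close>, and then
  the preimage of \<open>v\<close> against \<open>v\<close>; the order of two deletions is
  immaterial.\<close>

lemma Aut_subset_B_U:
  assumes "f \<in> Aut G"
  shows "f \<in> B_U G w v"
proof -
  have p: "f permutes verts G" and iso: "iso_onto f G G" using assms by (auto simp: Aut_def)
  have "inj f" using p permutes_inj by blast
  have 1: "iso_onto f (G -\<^sub>v w) (G -\<^sub>v f w)" using iso \<open>inj f\<close> by (rule iso_onto_del_vert)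
  have "iso_onto f (G -\<^sub>v w -\<^sub>v inv_into UNIV f v) (G -\<^sub>v f w -\<^sub>v f (inv_into UNIV f v))"
    using 1 \<open>inj f\<close> by (rule iso_onto_del_vert)
  moreover have "f (inv_into UNIV f v) = v" using p by (simp add: permutes_inverses)
  moreover have "G -\<^sub>v f w -\<^sub>v v = G -\<^sub>v v -\<^sub>v f w" by (auto simp: del_verts_def)
  ultimately show ?thesis using p 1 by (simp add: B_U_def B_vw_def)
qed

section \<open>Saturating sets\<close>

text \<open>Only finitely many permutations of the vertices exist, so \<open>Y\<close> lies in an
  inclusion-maximal separated set.\<close>

lemma max_saturating_extend:
  assumes "finite (verts G)" "Y \<subseteq> B_vw G w v" "id \<in> Y" "separated w v Y"
  shows "\<exists>X. Y \<subseteq> X \<and> max_saturating G w v X"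
proof -
  have "finite (B_vw G w v)"
    using finite_permutations[OF assms(1)] by (rule rev_finite_subset) (auto simp: B_vw_def)
  then have "finite {X. X \<subseteq> B_vw G w v \<and> id \<in> X \<and> separated w v X}" (is "finite ?A")
    by (rule_tac finite_subset[of _ "Pow (B_vw G w v)"]) auto
  moreover have "Y \<in> ?A" using assms by simp
  ultimately obtain X where X: "X \<in> ?A" "Y \<subseteq> X" "\<And>Z. Z \<in> ?A \<Longrightarrow> X \<subseteq> Z \<Longrightarrow> X = Z"
    using finite_has_maximal2[of ?A Y] by auto
  have "\<not> separated w v (insert s X)" if "s \<in> B_vw G w v - X" for s
    using X(1) X(3)[of "insert s X"] that by auto
  then show ?thesis using X by (auto simp: max_saturating_def)
qed

text \<open>As \<open>B_U\<close> consists of the automorphisms, its part of a saturating set is a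
  separated set of automorphisms, so \<open>bound\<close> limits \<open>chi\<close>. A maximal
  extension of \<open>Y\<close> attains that limit and can contain no further automorphism.\<close>

lemma optimum_saturating_exists:
  assumes fin: "finite (verts G)" and B: "B_U G w v = Aut G"
    and Y: "Y \<subseteq> Aut G" "id \<in> Y" "separated w v Y"
    and bound: "\<And>Z. Z \<subseteq> Aut G \<Longrightarrow> separated w v Z \<Longrightarrow> card Z \<le> card Y"
  shows "\<exists>X. optimum_saturating G w v X \<and> X \<inter> Aut G = Y"
proof -
  have "Y \<subseteq> B_vw G w v" using Y(1) B by (auto simp: B_U_def)
  then obtain X where X: "Y \<subseteq> X" "max_saturating G w v X"
    using max_saturating_extend[OF fin _ Y(2,3)] by blast
  have le: "card (Z \<inter> Aut G) \<le> card Y" if "max_saturating G w v Z" for Z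
    using that by (intro bound) (auto simp: max_saturating_def separated_def)
  have "finite (Aut G)"
    using finite_permutations[OF fin] by (rule rev_finite_subset) (auto simp: Aut_def)
  then have XY: "X \<inter> Aut G = Y"
    using le[OF X(2)] X(1) Y(1) card_seteq[of "X \<inter> Aut G" Y] by auto
  have "chi G w v = card Y"
    unfolding chi_def B
  proof (rule Max_eqI)
    show "finite {card (X \<inter> Aut G) |X. max_saturating G w v X}"
      by (rule finite_subset[of _ "{..card Y}"]) (use le in auto)
    show "card Y \<in> {card (X \<inter> Aut G) |X. max_saturating G w v X}"
      using X(2) XY by auto
  qed (use le in auto)
  then show ?thesis using X(2) XY B by (auto simp: optimum_saturating_def)
qed

section \<open>Transport of group structure to a set of permutations\<close>

lemma perm_group_transfer:
  assumes "group K" "bij_betw h (carrier K) S"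
    and mult: "\<And>a b. a \<in> carrier K \<Longrightarrow> b \<in> carrier K \<Longrightarrow> h (a \<otimes>\<^bsub>K\<^esub> b) = h a \<circ> h b"
    and one: "h \<one>\<^bsub>K\<^esub> = id"
  shows "group (perm_group S) \<and> perm_group S \<cong> K"
proof -
  interpret K: group K by fact
  have S: "h ` carrier K = S" using assms(2) by (simp add: bij_betw_def)
  \<comment> \<open>The target is merely the monoid of all functions under composition. The image of
    a group under a multiplicative map is a group even so, which gives closure and inverses for
    \<open>S\<close> at once.\<close>
  have "h \<in> hom K (perm_group UNIV)"
    using mult by (auto simp: hom_def perm_group_def)
  then have "group (perm_group UNIV \<lparr>carrier := h ` carrier K, one := h \<one>\<^bsub>K\<^esub>\<rparr>)"
    by (rule K.hom_imp_img_group)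
  then have g: "group (perm_group S)" using S one by (simp add: perm_group_def)
  have "h \<in> iso K (perm_group S)"
    using mult assms(2) S by (auto simp: iso_def hom_def perm_group_def)
  then have "K \<cong> perm_group S" by (auto simp: is_iso_def)
  then show ?thesis using g K.iso_sym by blast
qed

section \<open>Sunshine graphs with a labelling\<close>

locale labelled_sunshine =
  fixes G :: "'a sgraph" and w v :: 'a and c :: nat
    and x :: "int \<Rightarrow> 'a" and l :: "int \<Rightarrow> nat \<Rightarrow> 'a" and \<nu> :: int
  assumes sunshine: "sunshine G"
    and labelling: "labelling G w v c x l \<nu>"
    and w_leaf: "w \<in> verts G" "degree G w = 1"
begin

abbreviation d :: "int \<Rightarrow> nat" where "d i \<equiv> degree G (x i)"

lemma simple: "simple_graph G" and connected: "connected_graph G"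
  using sunshine by (auto simp: sunshine_def)

lemma finite_verts: "finite (verts G)"
  using simple by (simp add: simple_graph_def)

lemma x_periodic: "x (i + int c) = x i" and l_periodic: "l (i + int c) = l i"
  and x_bij: "bij_betw x {0..<int c} (verts (skeleton G))"
  and skeleton_edges: "edges (skeleton G) = {{x i, x (i + 1)} | i. True}"
  and l_bij: "bij_betw (l i) {1..d i - 2} {u \<in> verts G. degree G u = 1 \<and> {x i, u} \<in> edges G}"
  and x0_w: "{x 0, w} \<in> edges G" and w_eq: "w = l 0 1" and v_eq: "v = x \<nu>"
  using labelling by (auto simp: labelling_def)

lemma c_ge_3: "c \<ge> 3"
proof -
  obtain f k where "k \<ge> 3" "iso_onto f (skeleton G) (cycle_graph k)"
    using sunshine by (auto simp: sunshine_def is_cycle_def isomorphic_def)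
  then have "bij_betw f (verts (skeleton G)) {..<k}"
    by (simp add: iso_onto_def cycle_graph_def)
  then have "card (verts (skeleton G)) = k" using bij_betw_same_card by fastforce
  then show ?thesis using bij_betw_same_card[OF x_bij] \<open>k \<ge> 3\<close> by simp
qed

text \<open>The labelling makes \<open>x\<close> injective on one period only, so both indices are
  first reduced modulo \<open>c\<close>.\<close>

lemma x_eq_iff: "x i = x j \<longleftrightarrow> int c dvd i - j"
proof
  assume eq: "x i = x j"
  have m: "x k = x (k mod int c)" for k
    by (rule periodic_dvd[of _ "int c"]) (simp_all add: x_periodic)
  have "x (i mod int c) = x (j mod int c)" using eq m by metis
  then have "i mod int c = j mod int c"
    using x_bij c_ge_3 by (auto simp: bij_betw_def inj_on_def)
  then show "int c dvd i - j" by (simp add: mod_eq_dvd_iff)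
qed (rule periodic_dvd[of x "int c"], simp_all add: x_periodic)

lemma range_x: "range x = verts (skeleton G)"
proof -
  have "x k \<in> x ` {0..<int c}" for k
    using c_ge_3 x_eq_iff[of k "k mod int c"] by (intro image_eqI[of _ _ "k mod int c"]) auto
  then have "range x = x ` {0..<int c}" by blast
  then show ?thesis using x_bij by (simp add: bij_betw_def)
qed

lemma in_range_x_iff: "u \<in> range x \<longleftrightarrow> u \<in> verts G \<and> degree G u \<ge> 2"
  by (auto simp: range_x skeleton_def del_verts_def)

lemma x_in_verts: "x i \<in> verts G" and d_ge_2: "d i \<ge> 2"
  using in_range_x_iff by blast+

lemma cycle_edge: "{x i, x (i + 1)} \<in> edges G"
proof -
  have "{x i, x (i + 1)} \<in> edges (skeleton G)" using skeleton_edges by blast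
  then show ?thesis by (simp add: skeleton_def del_verts_def)
qed

lemma x_adjacent:
  assumes "{x i, x k} \<in> edges G"
  shows "x k = x (i + 1) \<or> x k = x (i - 1)"
proof -
  have "{x i, x k} \<in> edges (skeleton G)"
    using assms in_range_x_iff[of "x i"] in_range_x_iff[of "x k"]
    by (auto simp: skeleton_def del_verts_def)
  then obtain j where "{x i, x k} = {x j, x (j + 1)}" using skeleton_edges by auto
  then consider "x i = x j" "x k = x (j + 1)" | "x i = x (j + 1)" "x k = x j"
    by (auto simp: doubleton_eq_iff)
  then show ?thesis
  proof cases
    case 1
    then have "int c dvd (k - (j + 1)) - (i - j)" unfolding x_eq_iff by (rule_tac dvd_diff)
    then show ?thesis by (simp add: x_eq_iff algebra_simps)
  next
    case 2
    then have "int c dvd (k - j) - (i - (j + 1))" unfolding x_eq_iff by (rule_tac dvd_diff)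
    then show ?thesis by (simp add: x_eq_iff algebra_simps)
  qed
qed

lemma leaf:
  assumes "j \<in> {1..d i - 2}"
  shows "l i j \<in> verts G" "degree G (l i j) = 1" "{x i, l i j} \<in> edges G"
  using bij_betw_apply[OF l_bij assms] by auto

lemma leafE:
  assumes "u \<in> verts G" "degree G u = 1" "{x i, u} \<in> edges G"
  obtains j where "j \<in> {1..d i - 2}" "u = l i j"
proof -
  have "u \<in> l i ` {1..d i - 2}" using assms l_bij[of i] by (simp add: bij_betw_def)
  then show ?thesis using that by blast
qed

lemma degree_1_nbr_unique:
  assumes "degree G u \<le> 1" "{u, a} \<in> edges G" "{u, b} \<in> edges G"
  shows "a = b"
proof -
  have "card (nbrs G u) \<le> Suc 0" using assms(1) simple by (simp add: degree_eq_card_nbrs)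
  then show ?thesis using assms(2,3) card_le_Suc0_iff_eq[OF finite_nbrs[OF simple]]
    by (auto simp: nbrs_def)
qed

text \<open>A leaf determines its only neighbour, hence its index modulo \<open>c\<close>; at a
  fixed index the labels are injective.\<close>

lemma l_eq_iff:
  assumes "j \<in> {1..d i - 2}" "j' \<in> {1..d i' - 2}"
  shows "l i j = l i' j' \<longleftrightarrow> int c dvd i - i' \<and> j = j'"
proof
  assume eq: "l i j = l i' j'"
  then have "x i = x i'"
    using leaf[OF assms(1)] leaf[OF assms(2)] degree_1_nbr_unique[of "l i j" "x i" "x i'"]
    by (simp add: insert_commute)
  then have dv: "int c dvd i - i'" by (simp add: x_eq_iff)
  then have "l i = l i'" by (rule periodic_dvd[rotated]) (rule l_periodic)
  then show "int c dvd i - i' \<and> j = j'"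
    using dv eq assms l_bij[of i] \<open>x i = x i'\<close> by (auto simp: bij_betw_def inj_on_def)
next
  assume "int c dvd i - i' \<and> j = j'"
  then show "l i j = l i' j'" using periodic_dvd[of l "int c" i i'] l_periodic by auto
qed

lemma leaf_not_cycle: "j \<in> {1..d i - 2} \<Longrightarrow> l i j \<noteq> x k"
  using leaf(2)[of j i] d_ge_2[of k] by auto

text \<open>Connectedness rules out an edge between two vertices off the cycle: both would have
  degree at most 1, so the edge would be a whole component missing \<open>x 0\<close>.\<close>

lemma edge_cases:
  assumes "e \<in> edges G"
  obtains i where "e = {x i, x (i + 1)}" | i j where "j \<in> {1..d i - 2}" "e = {x i, l i j}"
proof -
  note cases = that
  have pendant: thesis if e: "e = {x i, b}" and b: "b \<notin> range x" for i b
  proof -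
    have V: "b \<in> verts G" using simple_graph_edge[OF simple] assms e by blast
    have "x i \<in> nbrs G b" using assms e by (auto simp: nbrs_def insert_commute)
    then have "degree G b \<noteq> 0"
      using finite_nbrs[OF simple] by (auto simp: degree_eq_card_nbrs[OF simple])
    moreover have "degree G b < 2" using b V in_range_x_iff[of b] by auto
    ultimately have "degree G b = 1" by simp
    then obtain j where "j \<in> {1..d i - 2}" "b = l i j"
      using leafE[of b i] V assms e by auto
    then show thesis using cases(2) e by simp
  qed
  obtain a b where e: "e = {a, b}" "a \<noteq> b"
    using assms simple by (auto simp: simple_graph_def card_2_iff)
  have ab: "a \<in> verts G" "b \<in> verts G" using simple_graph_edge[OF simple] assms e by blast+
  consider "a \<in> range x" "b \<in> range x" | "a \<in> range x" "b \<notin> range x"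
    | "a \<notin> range x" "b \<in> range x" | "a \<notin> range x" "b \<notin> range x" by blast
  then show thesis
  proof cases
    case 1
    then obtain i k where ik: "a = x i" "b = x k" by blast
    have "x k = x (i + 1) \<or> x k = x (i - 1)" using x_adjacent assms e ik by blast
    then show thesis
    proof
      assume "x k = x (i + 1)"
      then show thesis using that(1)[of i] e ik by simp
    next
      assume "x k = x (i - 1)"
      then show thesis using that(1)[of "i - 1"] e ik by (simp add: insert_commute)
    qed
  next
    case 2
    then show thesis using pendant e by blast
  next
    case 3
    then show thesis using pendant[of _ a] e by (auto simp: insert_commute)
  next
    case 4
    have deg: "degree G a \<le> 1" "degree G b \<le> 1"
      using 4 ab in_range_x_iff[of a] in_range_x_iff[of b] by auto
    have "(a, x 0) \<in> {(p, q). {p, q} \<in> edges G}\<^sup>*"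
      using connected ab x_in_verts by (simp add: connected_graph_def)
    \<comment> \<open>A walk that starts at \<open>a\<close> can only alternate between
      \<open>a\<close> and \<open>b\<close>.\<close>
    then have "x 0 \<in> {a, b}"
    proof (induction rule: rtrancl_induct)
      case (step y z)
      then have "{y, z} \<in> edges G" "y = a \<or> y = b" by auto
      then show ?case
        using degree_1_nbr_unique[OF deg(1), of b z] degree_1_nbr_unique[OF deg(2), of a z]
          assms e by (auto simp: insert_commute)
    qed simp
    then show thesis using 4 by auto
  qed
qed

text \<open>A vertex off the cycle has a neighbour, because its walk to \<open>x 0\<close> has a
  first edge.\<close>

lemma vert_cases:
  assumes "u \<in> verts G"
  obtains i where "u = x i" | i j where "j \<in> {1..d i - 2}" "u = l i j"
proof (cases "u \<in> range x")
  case True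
  then show ?thesis using that by blast
next
  case False
  have "(u, x 0) \<in> {(p, q). {p, q} \<in> edges G}\<^sup>*"
    using connected assms x_in_verts by (simp add: connected_graph_def)
  then obtain b where "{u, b} \<in> edges G" using False by (auto elim: converse_rtranclE)
  then show ?thesis
    by (rule edge_cases) (use False that in \<open>auto simp: doubleton_eq_iff\<close>)
qed

lemma fun_eq_on_labels:
  assumes "f permutes verts G" "g permutes verts G"
    and "\<And>i. f (x i) = g (x i)" "\<And>i j. j \<in> {1..d i - 2} \<Longrightarrow> f (l i j) = g (l i j)"
  shows "f = g"
proof
  fix u show "f u = g u"
  proof (cases "u \<in> verts G")
    case True
    then show ?thesis by (rule vert_cases) (use assms in auto)
  next
    case False
    then show ?thesis using assms by (simp add: permutes_not_in)
  qed
qed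

lemma w_leaf_index: "1 \<in> {1..d 0 - 2}"
proof -
  obtain j where "j \<in> {1..d 0 - 2}" using leafE[OF w_leaf x0_w] .
  then show ?thesis by auto
qed

lemma d_dvd: "int c dvd i - j \<Longrightarrow> d i = d j"
  using x_eq_iff by metis

section \<open>Maps of the cycle and the construction of reflections\<close>

text \<open>Each step along the cycle moves the image by one step forwards or backwards, and
  injectivity forbids turning back, so the direction is constant. The map need not be an
  automorphism, since elements of \<open>B_U\<close> are treated this way too.\<close>

lemma cycle_map_dihedral:
  assumes inj: "inj_on f (range x)" and C: "f ` range x \<subseteq> range x"
    and edge: "\<And>i. {f (x i), f (x (i + 1))} \<in> edges G"
  shows "\<exists>\<alpha>. (\<forall>i. f (x i) = x (\<alpha> + i)) \<or> (\<forall>i. f (x i) = x (\<alpha> - i))"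
proof -
  obtain \<alpha> where \<alpha>: "f (x 0) = x \<alpha>" using C by blast
  \<comment> \<open>A turn back would identify two indices that differ by 2, which is impossible for
    \<open>c \<ge> 3\<close>.\<close>
  have no: "f (x (i + 2)) \<noteq> f (x i)" for i
  proof
    assume "f (x (i + 2)) = f (x i)"
    then have "x (i + 2) = x i" using inj by (auto simp: inj_on_def)
    then have "int c dvd 2" by (simp add: x_eq_iff)
    then show False using c_ge_3 zdvd_imp_le by fastforce
  qed
  have step: "f (x (i + 1)) = x (a + 1) \<or> f (x (i + 1)) = x (a - 1)" if "f (x i) = x a" for i a
  proof -
    obtain b where "f (x (i + 1)) = x b" using C by blast
    then show ?thesis using x_adjacent[of a b] edge[of i] that by simp
  qed
  obtain s :: int where s: "f (x 1) = x (\<alpha> + s)" "s = 1 \<or> s = - 1"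
    using step[OF \<alpha>] by (metis add_0 diff_conv_add_uminus)
  \<comment> \<open>Two consecutive values are carried along: the later one leaves two candidates
    for the next value, and the earlier one excludes the wrong candidate.\<close>
  have nat: "f (x (int n)) = x (\<alpha> + s * int n) \<and>
      f (x (int n + 1)) = x (\<alpha> + s * (int n + 1))" for n
  proof (induction n)
    case 0
    then show ?case using \<alpha> s by simp
  next
    case (Suc n)
    let ?a = "\<alpha> + s * (int n + 1)"
    have "f (x (int n + 1 + 1)) = x (?a + 1) \<or> f (x (int n + 1 + 1)) = x (?a - 1)"
      using step Suc by blast
    moreover have "f (x (int n + 1 + 1)) \<noteq> x (\<alpha> + s * int n)"
      using no[of "int n"] Suc by (simp add: add.commute)
    ultimately have "f (x (int n + 1 + 1)) = x (\<alpha> + s * (int n + 1 + 1))"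
      using s(2) by (auto simp: algebra_simps)
    then show ?case using Suc by (simp add: algebra_simps)
  qed
  \<comment> \<open>The induction covers natural indices only; all others are reduced modulo
    \<open>c\<close>.\<close>
  have "f (x i) = x (\<alpha> + s * i)" for i
  proof -
    have nn: "int (nat (i mod int c)) = i mod int c" using c_ge_3 by simp
    have "int c dvd i - i mod int c" by simp
    then have "f (x i) = f (x (i mod int c))" using x_eq_iff by metis
    also have "\<dots> = x (\<alpha> + s * (i mod int c))" using nat[of "nat (i mod int c)"] nn by simp
    also have "\<dots> = x (\<alpha> + s * i)"
    proof -
      have "int c dvd s * (i - i mod int c)" by simp
      then have "int c dvd (\<alpha> + s * i) - (\<alpha> + s * (i mod int c))" by (simp add: right_diff_distrib)
      then show ?thesis using x_eq_iff by metis
    qed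
    finally show ?thesis .
  qed
  then show ?thesis using s(2) by auto
qed

text \<open>The cycle vertices are those of degree at least 2, so automorphisms preserve the
  cycle.\<close>

lemma Aut_dihedral:
  assumes "f \<in> Aut G"
  shows "f \<in> rotations G x \<or> f \<in> reflections G x"
proof -
  have p: "f permutes verts G" using assms by (simp add: Aut_def)
  have "f u \<in> range x" if "u \<in> range x" for u
    using that p Aut_degree[OF assms simple] by (simp add: in_range_x_iff permutes_in_image)
  then have "\<exists>\<alpha>. (\<forall>i. f (x i) = x (\<alpha> + i)) \<or> (\<forall>i. f (x i) = x (\<alpha> - i))"
    using p Aut_edge[OF assms simple cycle_edge] permutes_inj_on
    by (intro cycle_map_dihedral) blast+
  then show ?thesis using assms by (auto simp: rotations_def reflections_def)
qed

text \<open>A reflection may permute leaves with any order, but on the cycle it is an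
  involution.\<close>

lemma reflection_inv:
  assumes "f \<in> reflections G x"
  shows "inv_into UNIV f (x i) = f (x i)"
proof -
  obtain \<alpha> where "\<And>i. f (x i) = x (\<alpha> - i)" using assms by (auto simp: reflections_def)
  moreover have "f permutes verts G" using assms by (simp add: reflections_def Aut_def)
  ultimately show ?thesis by (simp add: permutes_inv_eq)
qed

text \<open>Exchanging the first two leaves, wherever there are two, makes the reflection move \<open>w\<close>
  to a leaf outside the orbit of \<open>w\<close> under the rotations even if it fixes that orbit on the
  cycle.\<close>

lemma reflection_exists:
  assumes sym: "\<And>i. d (\<alpha> - i) = d i"
  defines "\<tau> \<equiv> \<lambda>i. if d i \<ge> 4 then transpose 1 2 else id"
  shows "\<exists>f \<in> Aut G. (\<forall>i. f (x i) = x (\<alpha> - i)) \<and>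
    (\<forall>i. \<forall>j \<in> {1..d i - 2}. f (l i j) = l (\<alpha> - i) (\<tau> i j))"
proof -
  \<comment> \<open>Degree at least 4 means at least two leaves, so exchanging the labels 1 and 2
    stays in range; \<open>sym\<close> carries the condition over to the image vertex.\<close>
  have \<tau>_in: "\<tau> i j \<in> {1..d (\<alpha> - i) - 2}" if "j \<in> {1..d i - 2}" for i j
    using that sym[of i] by (auto simp: \<tau>_def transpose_def)
  have \<tau>_\<tau>: "\<tau> (\<alpha> - i) (\<tau> i j) = j" for i j
    using sym[of i] by (simp add: \<tau>_def)
  \<comment> \<open>A vertex has one label for each congruent index, so \<open>SOME\<close> picks
    one; \<open>fx\<close> and \<open>fl\<close> show that the choice does not matter.\<close>
  define lab where "lab u p \<longleftrightarrow> snd p \<in> {1..d (fst p) - 2} \<and> u = l (fst p) (snd p)" for u p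
  define f where "f u = (if u \<in> range x then x (\<alpha> - (SOME i. u = x i))
     else if u \<in> verts G then case (SOME p. lab u p) of (i, j) \<Rightarrow> l (\<alpha> - i) (\<tau> i j) else u)" for u
  have fx: "f (x i) = x (\<alpha> - i)" for i
  proof -
    have "x i = x (SOME k. x i = x k)" by (rule someI[of _ i]) simp
    then have "x (\<alpha> - (SOME k. x i = x k)) = x (\<alpha> - i)"
      by (simp add: x_eq_iff dvd_diff_commute)
    then show ?thesis by (simp add: f_def)
  qed
  have fl: "f (l i j) = l (\<alpha> - i) (\<tau> i j)" if ij: "j \<in> {1..d i - 2}" for i j
  proof -
    obtain i' j' where p: "(SOME p. lab (l i j) p) = (i', j')" by fastforce
    have "lab (l i j) (i', j')"
      unfolding p[symmetric] by (rule someI[of _ "(i, j)"]) (use ij in \<open>simp add: lab_def\<close>)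
    then have ij': "j' \<in> {1..d i' - 2}" and "l i j = l i' j'" by (auto simp: lab_def)
    then have dv: "int c dvd i - i'" and "j' = j" using l_eq_iff ij by blast+
    have "\<tau> i' = \<tau> i" using d_dvd[OF dv] by (simp add: \<tau>_def)
    moreover have "int c dvd (\<alpha> - i') - (\<alpha> - i)" using dv by simp
    ultimately have "l (\<alpha> - i') (\<tau> i' j') = l (\<alpha> - i) (\<tau> i j)"
      using \<open>j' = j\<close> l_eq_iff \<tau>_in[OF ij] \<tau>_in[OF ij'] by metis
    moreover have "l i j \<notin> range x" using leaf_not_cycle[OF ij] by blast
    ultimately show ?thesis using leaf(1)[OF ij] p by (simp add: f_def)
  qed
  have fl_fl: "f (f (l i j)) = l i j" if "j \<in> {1..d i - 2}" for i j
    using fl[OF that] fl[OF \<tau>_in[OF that]] \<tau>_\<tau> by simp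
  \<comment> \<open>Being its own inverse gives bijectivity and, further on, the converse direction
    of edge preservation.\<close>
  have invol: "f (f u) = u" for u
  proof (cases "u \<in> verts G")
    case True
    then show ?thesis by (rule vert_cases) (use fx fl_fl in auto)
  next
    case False
    then have "f u = u" using x_in_verts by (auto simp: f_def)
    then show ?thesis by simp
  qed
  have V: "f u \<in> verts G" if "u \<in> verts G" for u
    using that
  proof (rule vert_cases)
    fix i j assume "j \<in> {1..d i - 2}" "u = l i j"
    then show ?thesis using fl leaf(1)[OF \<tau>_in] by metis
  qed (simp add: fx x_in_verts)
  have perm: "f permutes verts G"
    unfolding permutes_def
  proof (intro conjI allI impI)
    show "f u = u" if "u \<notin> verts G" for u using that x_in_verts by (auto simp: f_def)
    show "\<exists>!u. f u = y" for y using invol by metis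
  qed
  have edge: "{f a, f b} \<in> edges G" if "{a, b} \<in> edges G" for a b
    using that
  proof (rule edge_cases)
    fix i assume "{a, b} = {x i, x (i + 1)}"
    then have "{f a, f b} = {x (\<alpha> - i - 1), x (\<alpha> - i - 1 + 1)}"
      by (auto simp: doubleton_eq_iff fx algebra_simps)
    then show ?thesis using cycle_edge[of "\<alpha> - i - 1"] by simp
  next
    fix i j assume ij: "j \<in> {1..d i - 2}" and "{a, b} = {x i, l i j}"
    then have "{f a, f b} = {x (\<alpha> - i), l (\<alpha> - i) (\<tau> i j)}"
      using fx[of i] fl[OF ij] by (auto simp: doubleton_eq_iff)
    then show ?thesis using leaf(3)[OF \<tau>_in[OF ij]] by simp
  qed
  have "{a, b} \<in> edges G \<longleftrightarrow> {f a, f b} \<in> edges G" for a b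
    using edge[of a b] edge[of "f a" "f b"] invol by auto
  then have "f \<in> Aut G"
    using perm permutes_imp_bij[OF perm] by (simp add: Aut_def iso_onto_def)
  then show ?thesis using fx fl by blast
qed

end

section \<open>The cyclic group of rotations generated by \<phi>\<close>

locale rotational_sunshine = labelled_sunshine +
  fixes \<delta> :: nat and \<phi> :: "'a \<Rightarrow> 'a"
  assumes nontrivial: "\<exists>\<rho> \<in> rotations G x. \<rho> (x 0) \<noteq> x 0"
    and delta: "\<delta> = rot_step G x"
    and phi: "label_rotation G x l \<delta> \<phi>"
begin

abbreviation m :: nat where "m \<equiv> c div \<delta>"

text \<open>Exponents are integers reduced modulo \<open>m\<close>, which makes the powers of \<phi>
  a homomorphic image of the integers and inversion a change of sign.\<close>

definition rot :: "int \<Rightarrow> 'a \<Rightarrow> 'a" where "rot a = \<phi> ^^ nat (a mod int m)"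

definition rots :: "('a \<Rightarrow> 'a) set" where "rots = {\<phi> ^^ k | k. k < m}"

lemma delta_pos: "0 < \<delta>"
  and delta_least: "\<And>\<beta> f. 0 < \<beta> \<Longrightarrow> f \<in> rotations G x \<Longrightarrow> x (int \<beta>) = f (x 0) \<Longrightarrow> \<delta> \<le> \<beta>"
proof -
  have id: "id \<in> rotations G x" using Aut_id by (auto simp: rotations_def intro: exI[of _ 0])
  \<comment> \<open>The identity realises the candidate \<open>c\<close>, so a least \<beta>
    exists.\<close>
  have "x (int c) = id (x 0)" using x_periodic[of 0] by simp
  then have c: "0 < c \<and> (\<exists>f \<in> rotations G x. x (int c) = f (x 0))" using id c_ge_3
    by (intro conjI bexI) simp_all
  show "0 < \<delta>" using LeastI[of "\<lambda>\<beta>. 0 < \<beta> \<and> (\<exists>f \<in> rotations G x. x (int \<beta>) = f (x 0))", OF c]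
    by (simp add: delta rot_step_def)
  show "\<delta> \<le> \<beta>" if "0 < \<beta>" "f \<in> rotations G x" "x (int \<beta>) = f (x 0)" for \<beta> f
    unfolding delta rot_step_def by (rule Least_le) (use that in auto)
qed

lemma phi_Aut: "\<phi> \<in> Aut G" and phi_x: "\<phi> (x i) = x (int \<delta> + i)"
  and phi_l: "j \<in> {1..d i - 2} \<Longrightarrow> \<phi> (l i j) = l (int \<delta> + i) j"
  using phi by (simp_all add: label_rotation_def)

lemma d_delta: "int \<delta> dvd i - j \<Longrightarrow> d i = d j"
proof (rule periodic_dvd[of d "int \<delta>"])
  show "d (k + int \<delta>) = d k" for k
    using Aut_degree[OF phi_Aut simple, of "x k"] by (simp add: phi_x add.commute)
qed

lemma phi_pow_x: "(\<phi> ^^ k) (x i) = x (int k * int \<delta> + i)"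
  by (induction k) (simp_all add: phi_x algebra_simps)

lemma phi_pow_l:
  assumes "j \<in> {1..d i - 2}"
  shows "(\<phi> ^^ k) (l i j) = l (int k * int \<delta> + i) j"
proof (induction k)
  case (Suc k)
  have "j \<in> {1..d (int k * int \<delta> + i) - 2}" using assms d_delta[of "int k * int \<delta> + i" i] by simp
  then show ?case using Suc phi_l by (simp add: algebra_simps)
qed simp

text \<open>Division with remainder: composing with a power of \<phi> leaves a rotation by the
  remainder, and a positive remainder would contradict the minimality of \<delta>.\<close>

lemma shift_dvd:
  assumes "f \<in> Aut G" "\<And>i. f (x i) = x (\<beta> + i)"
  shows "int \<delta> dvd \<beta>"
proof (rule ccontr)
  assume "\<not> int \<delta> dvd \<beta>"
  define q where "q = \<beta> div int \<delta>"
  define r where "r = \<beta> mod int \<delta>"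
  have "r \<noteq> 0" using \<open>\<not> int \<delta> dvd \<beta>\<close> by (auto simp: r_def)
  moreover have "0 \<le> r" "r < int \<delta>" using delta_pos by (simp_all add: r_def)
  ultimately have r: "0 < r" "r < int \<delta>" by simp_all
  have \<beta>: "\<beta> = q * int \<delta> + r" by (simp add: q_def r_def)
  \<comment> \<open>The power has to undo \<open>q\<close> steps by \<delta>, but its exponent must
    be natural, so \<open>- q\<close> is replaced by its residue modulo \<open>c\<close>.\<close>
  define k where "k = nat (- q mod int c)"
  have k: "int k = - q mod int c" using c_ge_3 by (simp add: k_def)
  have "int c dvd - q - (- q mod int c)" by (rule dvd_minus_mod)
  then have "int c dvd - (- q - int k)" using k by (simp only: dvd_minus_iff)
  then have kq: "int c dvd (int k + q) * int \<delta>" by (simp add: dvd_mult2 add.commute)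
  have g: "(\<phi> ^^ k \<circ> f) (x i) = x (r + i)" for i
  proof -
    have "(\<phi> ^^ k \<circ> f) (x i) = x (int k * int \<delta> + (\<beta> + i))" by (simp add: assms(2) phi_pow_x)
    also have "\<dots> = x (r + i)" using kq by (simp add: x_eq_iff \<beta> algebra_simps)
    finally show ?thesis .
  qed
  have "\<phi> ^^ k \<circ> f \<in> rotations G x"
    using g Aut_comp[OF Aut_funpow[OF phi_Aut] assms(1)] unfolding rotations_def by blast
  then have "\<delta> \<le> nat r" using delta_least[of "nat r"] g[of 0] r by simp
  then show False using r by linarith
qed

lemma delta_dvd_c: "int \<delta> dvd int c"
  by (rule shift_dvd[OF Aut_id]) (use x_periodic in \<open>simp add: add.commute\<close>)

lemma c_eq: "int c = int m * int \<delta>"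
proof -
  have "\<delta> dvd c" using delta_dvd_c by simp
  then have "c = m * \<delta>" by simp
  then show ?thesis by (metis of_nat_mult)
qed

lemma m_pos: "0 < m"
  using c_eq c_ge_3 by (cases m) auto

text \<open>Here the non-trivial rotation enters: if \<open>c\<close> divided \<delta>, it would
  divide every rotation's shift, and \<open>x 0\<close> would be fixed by all of them.\<close>

lemma not_c_dvd_delta: "\<not> int c dvd int \<delta>"
proof
  assume dv: "int c dvd int \<delta>"
  obtain \<rho> \<alpha> where \<rho>: "\<rho> \<in> Aut G" "\<And>i. \<rho> (x i) = x (\<alpha> + i)" "\<rho> (x 0) \<noteq> x 0"
    using nontrivial by (auto simp: rotations_def)
  have "int c dvd \<alpha>" using dv shift_dvd[OF \<rho>(1,2)] by (rule dvd_trans)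
  then show False using \<rho>(2)[of 0] \<rho>(3) by (simp add: x_eq_iff)
qed

lemma c_dvd_imp_delta_dvd: "int c dvd i \<Longrightarrow> int \<delta> dvd i"
  using delta_dvd_c dvd_trans by blast

lemma c_dvd_iff: "int c dvd a * int \<delta> - b * int \<delta> \<longleftrightarrow> int m dvd a - b"
  using delta_pos by (simp add: c_eq left_diff_distrib[symmetric])

lemma rot_dvd: "int c dvd int (nat (a mod int m)) * int \<delta> - a * int \<delta>"
  unfolding c_dvd_iff using m_pos by (simp add: mod_eq_dvd_iff[symmetric])

lemma rot_x: "rot a (x i) = x (a * int \<delta> + i)"
  using rot_dvd[of a] by (simp add: rot_def phi_pow_x x_eq_iff)

lemma d_rot: "d (a * int \<delta> + i) = d i"
  by (rule d_delta) simp

lemma rot_l: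
  assumes "j \<in> {1..d i - 2}"
  shows "rot a (l i j) = l (a * int \<delta> + i) j"
proof -
  have "l (int (nat (a mod int m)) * int \<delta> + i) = l (a * int \<delta> + i)"
    using rot_dvd[of a] by (rule_tac periodic_dvd[of l "int c"]) (simp_all add: l_periodic)
  then show ?thesis using phi_pow_l[OF assms] by (simp add: rot_def)
qed

lemma rot_Aut: "rot a \<in> Aut G"
  by (simp add: rot_def Aut_funpow phi_Aut)

lemma Aut_permutes: "f \<in> Aut G \<Longrightarrow> f permutes verts G"
  by (simp add: Aut_def)

lemma rot_add: "rot (a + b) = rot a \<circ> rot b"
proof (rule fun_eq_on_labels)
  fix i j assume j: "j \<in> {1..d i - 2}"
  then have "j \<in> {1..d (b * int \<delta> + i) - 2}" by (simp add: d_rot)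
  then show "rot (a + b) (l i j) = (rot a \<circ> rot b) (l i j)"
    using j by (simp only: rot_l comp_apply) (simp add: algebra_simps)
qed (simp_all add: Aut_permutes rot_Aut Aut_comp rot_x algebra_simps)

lemma rot_eq_iff: "rot a = rot b \<longleftrightarrow> int m dvd a - b"
proof
  assume "rot a = rot b"
  then have "rot a (x 0) = rot b (x 0)" by simp
  then show "int m dvd a - b" by (simp add: rot_x x_eq_iff c_dvd_iff)
next
  assume "int m dvd a - b"
  then show "rot a = rot b" by (simp add: rot_def mod_eq_dvd_iff[symmetric])
qed

lemma rot_0: "rot 0 = id"
  by (simp add: rot_def id_def)

lemma rot_mod: "rot (a mod int m) = rot a"
  by (simp add: rot_def)

lemma rots_eq_image: "rots = rot ` {0..<int m}"
proof (intro subset_antisym subsetI)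
  fix f assume "f \<in> rots"
  then obtain k where "k < m" "f = \<phi> ^^ k" by (auto simp: rots_def)
  then have "f = rot (int k)" "int k \<in> {0..<int m}" by (simp_all add: rot_def)
  then show "f \<in> rot ` {0..<int m}" by blast
next
  fix f assume "f \<in> rot ` {0..<int m}"
  then show "f \<in> rots" unfolding rots_def rot_def by (force simp: nat_less_iff)
qed

lemma rots_eq_range: "rots = range rot"
proof -
  have "rot a \<in> rot ` {0..<int m}" for a
    using m_pos rot_mod[of a] by (intro image_eqI[of _ _ "a mod int m"]) simp_all
  then show ?thesis by (auto simp: rots_eq_image)
qed

lemma inj_on_rot: "inj_on rot {0..<int m}"
  by (auto simp: inj_on_def rot_eq_iff mod_eq_dvd_iff[symmetric])

lemma bij_betw_rot: "bij_betw rot {0..<int m} rots"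
  by (simp add: bij_betw_def inj_on_rot rots_eq_image)

lemma card_rots: "card rots = m"
  using bij_betw_same_card[OF bij_betw_rot] by simp

lemma finite_orb: "finite (orb rots u)" and card_orb: "card (orb rots u) \<le> m"
proof -
  have orb: "orb rots u = (\<lambda>f. f u) ` rots" by (auto simp: orb_def)
  have "finite rots" by (simp add: rots_eq_image)
  then show "finite (orb rots u)" "card (orb rots u) \<le> m"
    using card_image_le[of rots "\<lambda>f. f u"] by (simp_all add: orb card_rots)
qed

text \<open>Orbit questions on the cycle thus become divisibility questions. As \<delta> divides
  \<open>c\<close>, the criterion does not depend on the indices chosen for the vertices.\<close>

lemma x_in_orb_iff: "x y \<in> orb rots (x i) \<longleftrightarrow> int \<delta> dvd y - i"
proof
  assume "x y \<in> orb rots (x i)"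
  then obtain a where "x y = x (a * int \<delta> + i)"
    by (auto simp: orb_def rots_eq_range rot_x)
  then have "int \<delta> dvd y - (a * int \<delta> + i)" by (simp add: x_eq_iff c_dvd_imp_delta_dvd)
  then have "int \<delta> dvd y - (a * int \<delta> + i) + a * int \<delta>" by (rule dvd_add) simp
  then show "int \<delta> dvd y - i" by simp
next
  assume "int \<delta> dvd y - i"
  then obtain q where "y - i = int \<delta> * q" by (auto simp: dvd_def)
  then have "x y = rot q (x i)" by (simp add: rot_x algebra_simps)
  then show "x y \<in> orb rots (x i)" unfolding orb_def rots_eq_range by blast
qed

text \<open>Suppose that \<open>f\<close> maps \<open>G - w\<close> onto \<open>G - f w\<close> but the neighbour \<open>x\<^sub>s\<close> of \<open>f w\<close> is not
  \<open>f x\<^sub>0\<close>. Then \<open>f\<close> lowers the degree at \<open>x\<^sub>0\<close>, raises it at \<open>f\<^sup>-\<^sup>1 x\<^sub>s\<close>, and preserves it at all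
  other vertices of the cycle, which is impossible if the degrees have a period \<open>\<delta> < c\<close>.\<close>

lemma B_U_subset_Aut:
  assumes "f \<in> B_U G w v"
  shows "f \<in> Aut G"
proof -
  define u where "u = f w"
  have p: "f permutes verts G" and iso: "iso_onto f (G -\<^sub>v w) (G -\<^sub>v u)"
    using assms by (auto simp: B_U_def B_vw_def u_def)
  have inj: "f a = f b \<longleftrightarrow> a = b" for a b using permutes_inj[OF p] by (auto simp: inj_def)
  have w_edge: "{y, w} \<in> edges G \<longleftrightarrow> y = x 0" for y
    using degree_1_nbr_unique[of w y "x 0"] w_leaf x0_w by (auto simp: insert_commute)
  have xw: "x i \<noteq> w" for i using d_ge_2[of i] w_leaf(2) by auto
  have degw: "degree (G -\<^sub>v w) (x i) = (if x i = x 0 then d i - 1 else d i)" for i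
    using degree_del_vert[OF simple xw] by (simp add: w_edge)
  have deg: "degree (G -\<^sub>v u) (f y) = degree (G -\<^sub>v w) y" if "y \<in> verts G" "y \<noteq> w" for y
    using degree_iso_onto[OF iso simple_graph_del_verts simple_graph_del_verts, OF simple simple] that
    by (simp add: del_verts_def)
  \<comment> \<open>The vertex \<open>x 0\<close> has a leaf and so degree at least 3; hence no
    cycle vertex drops below degree 2 when \<open>w\<close> is deleted.\<close>
  have C: "f ` range x \<subseteq> range x"
  proof
    fix y assume "y \<in> f ` range x"
    then obtain i where i: "y = f (x i)" by blast
    have "2 \<le> degree (G -\<^sub>v w) (x i)" using w_leaf_index d_ge_2[of i] by (auto simp: degw)
    then have "2 \<le> degree (G -\<^sub>v u) y" using deg[OF x_in_verts xw] i by simp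
    moreover have "y \<noteq> u" using i inj xw by (simp add: u_def)
    ultimately have "2 \<le> degree G y"
      using degree_del_vert_le[OF simple, of y u] by linarith
    then show "y \<in> range x" using i p x_in_verts by (simp add: in_range_x_iff permutes_in_image)
  qed
  \<comment> \<open>An injection of the finite cycle into itself is onto, so \<open>f w\<close> lies
    off the cycle and is a leaf.\<close>
  have "finite (range x)"
    using finite_subset[OF _ finite_verts] x_in_verts by blast
  then have "f ` range x = range x"
    using C inj by (intro endo_inj_surj) (auto simp: inj_on_def)
  then have "u \<notin> range x"
    using xw permutes_inj[OF p] inj_image_mem_iff[of f w "range x"] by (auto simp: u_def)
  moreover have "u \<in> verts G" using p w_leaf(1) by (simp add: u_def permutes_in_image)
  ultimately obtain s j where "j \<in> {1..d s - 2}" "u = l s j"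
    by (metis rangeI vert_cases)
  then have u_leaf: "degree G u = 1" "{x s, u} \<in> edges G" using leaf by auto
  have u_edge: "{y, u} \<in> edges G \<longleftrightarrow> y = x s" for y
    using degree_1_nbr_unique[of u y "x s"] u_leaf by (auto simp: insert_commute)
  have xu: "x k \<noteq> u" for k using \<open>u \<notin> range x\<close> by blast
  have degu: "degree (G -\<^sub>v u) (x k) = (if x k = x s then d k - 1 else d k)" for k
    using degree_del_vert[OF simple xu] by (simp add: u_edge)
  have edge: "{a, b} \<in> edges G \<longleftrightarrow> {f a, f b} \<in> edges G"
    if "a \<in> verts G" "b \<in> verts G" "a \<noteq> w" "b \<noteq> w" for a b
  proof -
    have "a \<in> verts (G -\<^sub>v w)" "b \<in> verts (G -\<^sub>v w)" using that by (simp_all add: del_verts_def)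
    then have "{a, b} \<in> edges (G -\<^sub>v w) \<longleftrightarrow> {f a, f b} \<in> edges (G -\<^sub>v u)"
      using iso unfolding iso_onto_def by blast
    then show ?thesis using that inj by (auto simp: del_verts_def u_def)
  qed
  have "\<exists>\<alpha>. (\<forall>i. f (x i) = x (\<alpha> + i)) \<or> (\<forall>i. f (x i) = x (\<alpha> - i))"
  proof (rule cycle_map_dihedral[OF _ C])
    show "inj_on f (range x)" using permutes_inj_on[OF p] .
    show "{f (x i), f (x (i + 1))} \<in> edges G" for i
      using edge[OF x_in_verts x_in_verts xw xw] cycle_edge by blast
  qed
  \<comment> \<open>The sign \<open>e\<close> treats rotations and reflections of the cycle
    together.\<close>
  then obtain \<alpha> e where e: "e = 1 \<or> e = (- 1 :: int)" and f: "\<And>i. f (x i) = x (\<alpha> + e * i)"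
    by (metis diff_conv_add_uminus mult_1 mult_minus_left)
  have degs: "(if x (\<alpha> + e * i) = x s then d (\<alpha> + e * i) - 1 else d (\<alpha> + e * i)) =
      (if x i = x 0 then d i - 1 else d i)" for i
    using deg[OF x_in_verts xw, of i] by (simp only: f degw degu)
  have xs: "x s = f (x 0)"
  proof (rule ccontr)
    assume ne: "x s \<noteq> f (x 0)"
    then have d0: "d \<alpha> = d 0 - 1" using degs[of 0] f[of 0] by auto
    show False
    proof (cases "int \<delta> dvd s - \<alpha>")
      case True
      \<comment> \<open>\<open>x t\<close> is the preimage of \<open>x s\<close>. Periodicity gives
        it the degree of \<open>x 0\<close> and gives \<open>x s\<close> the degree of
        \<open>x \<alpha>\<close>, but one degree drops by 1 and the other rises by 1.\<close>
      define t where "t = e * (s - \<alpha>)"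
      have t: "\<alpha> + e * t = s" using e by (auto simp: t_def)
      then have "f (x t) = x s" using f by simp
      then have "x t \<noteq> x 0" using ne by auto
      then have "d s - 1 = d t" using degs[of t] t by simp
      moreover have "d t = d 0" using True by (intro d_delta) (simp add: t_def)
      moreover have "d s = d \<alpha>" using True by (rule d_delta)
      ultimately show False using d0 w_leaf_index by auto
    next
      case False
      \<comment> \<open>The vertex \<open>x \<delta>\<close> differs from \<open>x 0\<close> and its
        image from \<open>x s\<close>, so its degree is preserved; by periodicity \<open>x 0\<close>
        and \<open>x \<alpha>\<close> then have equal degrees.\<close>
      have "x (\<alpha> + e * int \<delta>) \<noteq> x s"
      proof
        assume "x (\<alpha> + e * int \<delta>) = x s"
        then have "int \<delta> dvd \<alpha> + e * int \<delta> - s" by (simp add: x_eq_iff c_dvd_imp_delta_dvd)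
        then have "int \<delta> dvd e * int \<delta> - (\<alpha> + e * int \<delta> - s)" by (rule dvd_diff[rotated]) simp
        then show False using False by simp
      qed
      moreover have "x (int \<delta>) \<noteq> x 0" using not_c_dvd_delta by (simp add: x_eq_iff)
      ultimately have "d (\<alpha> + e * int \<delta>) = d (int \<delta>)" using degs[of "int \<delta>"] by simp
      moreover have "d (\<alpha> + e * int \<delta>) = d \<alpha>" by (rule d_delta) simp
      moreover have "d (int \<delta>) = d 0" by (rule d_delta) simp
      ultimately show False using d0 w_leaf_index by auto
    qed
  qed
  \<comment> \<open>With \<open>f (x 0)\<close> adjacent to \<open>f w\<close>, the one edge lost by
    deleting \<open>w\<close> is preserved as well.\<close>
  have w_iff: "{a, w} \<in> edges G \<longleftrightarrow> {f a, f w} \<in> edges G" for a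
    using w_edge[of a] u_edge[of "f a"] xs inj by (simp add: u_def)
  have "{a, b} \<in> edges G \<longleftrightarrow> {f a, f b} \<in> edges G" if "a \<in> verts G" "b \<in> verts G" for a b
    using edge[OF that] w_iff[of a] w_iff[of b]
    by (cases "a = w"; cases "b = w") (simp_all add: insert_commute)
  then show ?thesis using p permutes_imp_bij[OF p] by (simp add: Aut_def iso_onto_def)
qed

lemma B_U_eq_Aut: "B_U G w v = Aut G"
  by (intro subset_antisym subsetI) (fact B_U_subset_Aut Aut_subset_B_U)+

section \<open>Orbits under rotations and reflections\<close>

lemma rotation_inv_in_orb:
  assumes "f \<in> rotations G x"
  shows "inv_into UNIV f (x i) \<in> orb rots (x i)"
proof -
  obtain \<alpha> where \<alpha>: "\<And>i. f (x i) = x (\<alpha> + i)" and f: "f \<in> Aut G"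
    using assms by (auto simp: rotations_def)
  have "inv_into UNIV f (x i) = x (i - \<alpha>)" using Aut_permutes[OF f] \<alpha> by (simp add: permutes_inv_eq)
  then show ?thesis using shift_dvd[OF f \<alpha>] by (simp add: x_in_orb_iff)
qed

text \<open>The composite of two reflections is a rotation. Consequently all reflections send a
  given cycle vertex into one orbit of the rotations.\<close>

lemma reflections_dvd:
  assumes "f \<in> Aut G" "\<And>i. f (x i) = x (\<alpha> - i)" "g \<in> Aut G" "\<And>i. g (x i) = x (\<beta> - i)"
  shows "int \<delta> dvd \<alpha> - \<beta>"
  by (rule shift_dvd[OF Aut_comp[OF assms(1,3)]]) (simp add: assms(2,4) algebra_simps)

lemma rot_w: "rot a w = l (a * int \<delta>) 1"
  using rot_l[OF w_leaf_index, of a] by (simp add: w_eq)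

lemma inv_rot: "inv_into UNIV (rot a) (x i) = x (i - a * int \<delta>)"
  by (simp add: permutes_inv_eq[OF Aut_permutes[OF rot_Aut]] rot_x)

lemma leaf_orbit: "j \<in> {1..d 0 - 2} \<Longrightarrow> j \<in> {1..d (a * int \<delta>) - 2}"
  using d_rot[of a 0] by simp

text \<open>The exponent modulo \<open>m\<close> can be read off from the preimage of
  \<open>v\<close> alone, and also from the image of \<open>w\<close> alone.\<close>

lemma separated_rots: "separated w v rots"
proof -
  have "int m dvd a - b"
    if "inv_into UNIV (rot a) v = inv_into UNIV (rot b) v \<or> rot a w = rot b w" for a b
    using that
  proof
    assume "inv_into UNIV (rot a) v = inv_into UNIV (rot b) v"
    then have "int c dvd b * int \<delta> - a * int \<delta>" by (simp add: v_eq inv_rot x_eq_iff)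
    then show ?thesis by (simp add: c_dvd_iff dvd_diff_commute)
  next
    assume "rot a w = rot b w"
    then show ?thesis
      using l_eq_iff[OF leaf_orbit[OF w_leaf_index] leaf_orbit[OF w_leaf_index], of a b]
      by (simp add: rot_w c_dvd_iff)
  qed
  then show ?thesis unfolding separated_def rots_eq_range by (auto simp: rot_eq_iff)
qed

lemma rots_optimum:
  assumes "\<And>Z. Z \<subseteq> Aut G \<Longrightarrow> separated w v Z \<Longrightarrow> card Z \<le> m"
  shows "\<exists>X. optimum_saturating G w v X \<and> X \<inter> Aut G = rots"
proof (rule optimum_saturating_exists[OF finite_verts B_U_eq_Aut])
  show "rots \<subseteq> Aut G" "id \<in> rots" using rot_Aut rot_0 by (auto simp: rots_eq_range) (metis rangeI)
qed (use assms separated_rots card_rots in auto)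

lemma rots_group:
  "group (perm_group rots) \<and> perm_group rots \<cong> integer_mod_group m"
proof (rule perm_group_transfer[of _ rot])
  show "rot (a \<otimes>\<^bsub>integer_mod_group m\<^esub> b) = rot a \<circ> rot b" for a b
    by (simp add: mult_integer_mod_group rot_mod rot_add)
qed (use m_pos bij_betw_rot rot_0 in \<open>auto simp: carrier_integer_mod_group\<close>)

section \<open>The two cyclic cases\<close>

lemma rots_optimum_case_i:
  assumes "{\<rho> v | \<rho>. \<rho> \<in> reflections G x} \<subseteq> orb rots v"
  shows "\<exists>X. optimum_saturating G w v X \<and> X \<inter> Aut G = rots"
proof (rule rots_optimum)
  fix Z assume Z: "Z \<subseteq> Aut G" "separated w v Z"
  have "inv_into UNIV f v \<in> orb rots v" if "f \<in> Z" for f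
  proof -
    consider "f \<in> rotations G x" | "f \<in> reflections G x" using Aut_dihedral[of f] \<open>f \<in> Z\<close> Z(1) by blast
    then show ?thesis
    proof cases
      case 1
      then show ?thesis using rotation_inv_in_orb v_eq by simp
    next
      case 2
      then show ?thesis using reflection_inv v_eq assms by auto
    qed
  qed
  then have "card Z \<le> card (orb rots v)"
    using Z(2) by (intro card_inj_on_le[of "\<lambda>f. inv_into UNIV f v"] finite_orb)
      (auto simp: inj_on_def separated_def)
  then show "card Z \<le> m" using card_orb le_trans by blast
qed

lemma rots_optimum_case_ii:
  assumes d0: "d 0 = 3" and "{\<rho> (x 0) | \<rho>. \<rho> \<in> reflections G x} \<subseteq> orb rots (x 0)"
  shows "\<exists>X. optimum_saturating G w v X \<and> X \<inter> Aut G = rots"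
proof (rule rots_optimum)
  fix Z assume Z: "Z \<subseteq> Aut G" "separated w v Z"
  have "f w \<in> orb rots w" if "f \<in> Z" for f
  proof -
    have f: "f \<in> Aut G" using that Z(1) by blast
    have "f (x 0) \<in> orb rots (x 0)"
    proof (cases "f \<in> reflections G x")
      case True
      then show ?thesis using assms(2) by blast
    next
      case False
      then obtain \<alpha> where \<alpha>: "\<And>i. f (x i) = x (\<alpha> + i)"
        using Aut_dihedral[OF f] by (auto simp: rotations_def)
      then show ?thesis using shift_dvd[OF f \<alpha>] by (simp add: x_in_orb_iff)
    qed
    then obtain a where a: "f (x 0) = x (a * int \<delta>)"
      by (auto simp: orb_def rots_eq_range rot_x)
    have "{x (a * int \<delta>), f w} \<in> edges G" using Aut_edge[OF f simple x0_w] a by simp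
    moreover have "f w \<in> verts G" using Aut_permutes[OF f] w_leaf by (simp add: permutes_in_image)
    moreover have "degree G (f w) = 1" using Aut_degree[OF f simple] w_leaf by simp
    ultimately obtain j where "j \<in> {1..d (a * int \<delta>) - 2}" "f w = l (a * int \<delta>) j"
      using leafE by metis
    \<comment> \<open>Each vertex in the orbit of \<open>x 0\<close> has degree 3 and so a single
      leaf, which leaves no choice for \<open>f w\<close>.\<close>
    moreover from this have "j = 1" using d0 d_rot[of a 0] by auto
    ultimately have "f w = rot a w" by (simp add: rot_w)
    then show ?thesis unfolding orb_def rots_eq_range by blast
  qed
  then have "card Z \<le> card (orb rots w)"
    using Z(2) by (intro card_inj_on_le[of "\<lambda>f. f w"] finite_orb)
      (auto simp: inj_on_def separated_def)
  then show "card Z \<le> m" using card_orb le_trans by blast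
qed

section \<open>The dihedral case\<close>

lemma dihedral_optimum:
  assumes not_i: "\<not> {\<rho> v | \<rho>. \<rho> \<in> reflections G x} \<subseteq> orb rots v"
    and not_ii: "\<not> (d 0 = 3 \<and> {\<rho> (x 0) | \<rho>. \<rho> \<in> reflections G x} \<subseteq> orb rots (x 0))"
  shows "\<exists>\<pi> \<in> reflections G x. \<exists>X. optimum_saturating G w v X \<and>
    X \<inter> Aut G = rots \<union> {\<rho> \<circ> \<pi> | \<rho>. \<rho> \<in> rots} \<and>
    group (perm_group (X \<inter> Aut G)) \<and> perm_group (X \<inter> Aut G) \<cong> dihedral_group m"
proof -
  \<comment> \<open>A reflection violating case (i) supplies \<alpha>; by
    \<open>reflections_dvd\<close> any other reflection has the same index sum modulo
    \<delta>.\<close>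
  obtain \<rho> where \<rho>: "\<rho> \<in> reflections G x" "\<rho> v \<notin> orb rots v" using not_i by blast
  then obtain \<alpha> where \<alpha>: "\<And>i. \<rho> (x i) = x (\<alpha> - i)" and \<rho>_Aut: "\<rho> \<in> Aut G"
    by (auto simp: reflections_def)
  have \<alpha>_v: "\<not> int \<delta> dvd \<alpha> - \<nu> - \<nu>" using \<rho>(2) by (simp add: v_eq \<alpha> x_in_orb_iff)
  have sym: "d (\<alpha> - i) = d i" for i using Aut_degree[OF \<rho>_Aut simple, of "x i"] by (simp add: \<alpha>)
  define \<tau> where "\<tau> i = (if d i \<ge> 4 then transpose 1 2 else id :: nat \<Rightarrow> nat)" for i
  \<comment> \<open>\<rho> may permute leaves arbitrarily and need not be an involution. \<pi> acts
    on the cycle in the same way, squares to the identity and inverts the rotations.\<close>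
  obtain \<pi> where \<pi>: "\<pi> \<in> Aut G" "\<And>i. \<pi> (x i) = x (\<alpha> - i)"
    "\<And>i j. j \<in> {1..d i - 2} \<Longrightarrow> \<pi> (l i j) = l (\<alpha> - i) (\<tau> i j)"
    using reflection_exists[OF sym] unfolding \<tau>_def by blast
  have \<pi>_refl: "\<pi> \<in> reflections G x" using \<pi> by (auto simp: reflections_def)
  have \<tau>_in: "\<tau> i j \<in> {1..d (\<alpha> - i) - 2}" if "j \<in> {1..d i - 2}" for i j
    using that sym[of i] by (auto simp: \<tau>_def transpose_def)
  have \<tau>_\<tau>: "\<tau> (\<alpha> - i) (\<tau> i j) = j" for i j using sym[of i] by (simp add: \<tau>_def)
  have \<pi>_\<pi>: "\<pi> \<circ> \<pi> = id"
  proof (rule fun_eq_on_labels)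
    show "(\<pi> \<circ> \<pi>) (l i j) = id (l i j)" if "j \<in> {1..d i - 2}" for i j
      using \<pi>(3)[OF that] \<pi>(3)[OF \<tau>_in[OF that]] \<tau>_\<tau> by simp
  qed (use \<pi> in \<open>simp_all add: Aut_permutes Aut_comp permutes_id\<close>)
  have \<pi>_rot: "\<pi> \<circ> rot b = rot (- b) \<circ> \<pi>" for b
  proof (rule fun_eq_on_labels)
    show "(\<pi> \<circ> rot b) (l i j) = (rot (- b) \<circ> \<pi>) (l i j)" if j: "j \<in> {1..d i - 2}" for i j
    proof -
      have "j \<in> {1..d (b * int \<delta> + i) - 2}" using j by (simp add: d_rot)
      moreover have "\<tau> (b * int \<delta> + i) = \<tau> i" by (simp add: \<tau>_def d_rot)
      ultimately show ?thesis
        using rot_l[OF j] \<pi>(3)[OF j] rot_l[OF \<tau>_in[OF j]] \<pi>(3) by (simp add: algebra_simps)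
    qed
  qed (use \<pi> in \<open>simp_all add: Aut_permutes Aut_comp rot_Aut rot_x algebra_simps\<close>)

  \<comment> \<open>This is the intended isomorphism from the dihedral group, extended to all
    integers so that sums of exponents need no reduction.\<close>
  define h where "h p = rot (fst p) \<circ> (if snd p then \<pi> else id)" for p :: "int \<times> bool"
  define D where "D = rots \<union> {\<rho> \<circ> \<pi> | \<rho>. \<rho> \<in> rots}"
  have D_range: "D = range h"
  proof -
    have "range h = range (\<lambda>a. h (a, False)) \<union> range (\<lambda>a. h (a, True))"
    proof (intro subset_antisym subsetI)
      fix f assume "f \<in> range h"
      then obtain a e where "f = h (a, e)" by auto
      then show "f \<in> range (\<lambda>a. h (a, False)) \<union> range (\<lambda>a. h (a, True))" by (cases e) auto
    qed auto
    then show ?thesis by (auto simp: D_def h_def rots_eq_range)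
  qed
  have h_mod: "h (a mod int m, e) = h (a, e)" for a e by (simp add: h_def rot_mod)
  have "D \<subseteq> h ` ({0..<int m} \<times> UNIV)"
  proof
    fix f assume "f \<in> D"
    then obtain a e where "f = h (a, e)" by (auto simp: D_range)
    then show "f \<in> h ` ({0..<int m} \<times> UNIV)"
      using m_pos h_mod[of a e] by (intro image_eqI[of _ _ "(a mod int m, e)"]) simp_all
  qed
  then have D_image: "h ` ({0..<int m} \<times> UNIV) = D" by (auto simp: D_range)
  have D_Aut: "D \<subseteq> Aut G" by (auto simp: D_range h_def intro!: rot_Aut Aut_comp Aut_id \<pi>(1))

  \<comment> \<open>The label of the leaf \<open>\<pi> w\<close> at \<open>x \<alpha>\<close>: 2 if
    \<open>d 0 \<ge> 4\<close>, and 1 otherwise.\<close>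
  define j0 :: nat where "j0 = \<tau> 0 1"
  have j0: "j0 \<in> {1..d (a * int \<delta> + \<alpha>) - 2}" for a
    using \<tau>_in[OF w_leaf_index] d_rot[of a \<alpha>] by (simp add: j0_def)
  have h_v: "inv_into UNIV (h (a, e)) v = (if e then x (a * int \<delta> + \<alpha> - \<nu>) else x (\<nu> - a * int \<delta>))"
    for a e
  proof (cases e)
    case True
    have "h (a, e) \<in> Aut G" using D_Aut by (auto simp: D_range)
    moreover have h_x: "h (a, e) (x i) = x ((a * int \<delta> + \<alpha>) - i)" for i
      using True by (simp add: h_def rot_x \<pi>(2) algebra_simps)
    ultimately have "h (a, e) \<in> reflections G x" unfolding reflections_def by blast
    then show ?thesis using True reflection_inv[of "h (a, e)" \<nu>] h_x[of \<nu>] by (simp add: v_eq)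
  next
    case False
    then show ?thesis by (simp add: h_def v_eq inv_rot)
  qed
  have h_w: "h (a, e) w = (if e then l (a * int \<delta> + \<alpha>) j0 else l (a * int \<delta>) 1)" for a e
  proof -
    have "\<pi> w = l (\<alpha> - 0) j0" using \<pi>(3)[OF w_leaf_index] w_eq j0_def by metis
    moreover have "rot a (l (\<alpha> - 0) j0) = l (a * int \<delta> + (\<alpha> - 0)) j0"
      unfolding j0_def by (rule rot_l[OF \<tau>_in[OF w_leaf_index]])
    ultimately show ?thesis by (simp add: h_def rot_w)
  qed

  \<comment> \<open>By the choice of \<rho>, \<delta> does not divide
    \<open>\<alpha> - 2 * \<nu>\<close>, so the two orbits of preimages of \<open>v\<close> are
    disjoint.\<close>
  have mixed_v: "x (a * int \<delta> + \<alpha> - \<nu>) \<noteq> x (\<nu> - b * int \<delta>)" for a b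
  proof
    assume "x (a * int \<delta> + \<alpha> - \<nu>) = x (\<nu> - b * int \<delta>)"
    then have "int \<delta> dvd (a * int \<delta> + \<alpha> - \<nu>) - (\<nu> - b * int \<delta>)"
      by (simp add: x_eq_iff c_dvd_imp_delta_dvd)
    then have "int \<delta> dvd (a * int \<delta> + \<alpha> - \<nu>) - (\<nu> - b * int \<delta>) - (a + b) * int \<delta>"
      by (rule dvd_diff) simp
    then show False using \<alpha>_v by (simp add: algebra_simps)
  qed
  \<comment> \<open>Equality forces \<open>j0 = 1\<close>, hence \<open>d 0 = 3\<close>, and makes
    \<delta> divide \<alpha>. Every reflection would then keep \<open>x 0\<close> in its orbit,
    which is case (ii).\<close>
  have mixed_w: "l (a * int \<delta> + \<alpha>) j0 \<noteq> l (b * int \<delta>) 1" for a b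
  proof
    assume eq: "l (a * int \<delta> + \<alpha>) j0 = l (b * int \<delta>) 1"
    then have dv: "int c dvd a * int \<delta> + \<alpha> - b * int \<delta>" and "j0 = 1"
      using l_eq_iff[OF j0 leaf_orbit[OF w_leaf_index]] by blast+
    then have "d 0 = 3" using w_leaf_index by (auto simp: j0_def \<tau>_def split: if_splits)
    then obtain \<sigma> where \<sigma>: "\<sigma> \<in> reflections G x" "\<sigma> (x 0) \<notin> orb rots (x 0)"
      using not_ii by blast
    then obtain \<beta> where \<beta>: "\<And>i. \<sigma> (x i) = x (\<beta> - i)" and "\<sigma> \<in> Aut G"
      by (auto simp: reflections_def)
    have "int \<delta> dvd \<beta> - \<alpha>" using reflections_dvd[OF \<open>\<sigma> \<in> Aut G\<close> \<beta> \<pi>(1,2)] .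
    moreover have "int \<delta> dvd a * int \<delta> + \<alpha> - b * int \<delta> - (a - b) * int \<delta>"
      using c_dvd_imp_delta_dvd[OF dv] by (rule dvd_diff) simp
    ultimately have "int \<delta> dvd (\<beta> - \<alpha>) + (a * int \<delta> + \<alpha> - b * int \<delta> - (a - b) * int \<delta>)"
      by (rule dvd_add)
    then have "int \<delta> dvd \<beta>" by (simp add: algebra_simps)
    then show False using \<sigma>(2) by (simp add: \<beta> x_in_orb_iff)
  qed
  \<comment> \<open>Either vertex recovers the element: the mixed inequalities determine
    \<open>e\<close>, and the index then determines \<open>a\<close> modulo \<open>m\<close>.
    Separation and injectivity of \<open>h\<close> both follow.\<close>
  have h_sep: "e = e' \<and> int m dvd a - b"
    if "inv_into UNIV (h (a, e)) v = inv_into UNIV (h (b, e')) v \<or> h (a, e) w = h (b, e') w"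
    for a b e e'
    using that
  proof
    assume eq: "inv_into UNIV (h (a, e)) v = inv_into UNIV (h (b, e')) v"
    then have "e = e'" using mixed_v[of a b] mixed_v[of b a]
      by (cases e; cases e') (auto simp: h_v)
    moreover have "int c dvd a * int \<delta> - b * int \<delta>"
      using eq \<open>e = e'\<close> by (cases e) (simp_all add: h_v x_eq_iff dvd_diff_commute)
    ultimately show ?thesis by (simp add: c_dvd_iff)
  next
    assume eq: "h (a, e) w = h (b, e') w"
    then have "e = e'" using mixed_w[of a b] mixed_w[of b a]
      by (cases e; cases e') (auto simp: h_w)
    moreover have "int c dvd a * int \<delta> - b * int \<delta>"
      using eq \<open>e = e'\<close> l_eq_iff[OF j0 j0, of a b]
        l_eq_iff[OF leaf_orbit[OF w_leaf_index] leaf_orbit[OF w_leaf_index], of a b]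
      by (auto simp: h_w split: if_splits)
    ultimately show ?thesis by (simp add: c_dvd_iff)
  qed
  have h_cong: "h (a, e) = h (b, e)" if "int m dvd a - b" for a b e
    using rot_eq_iff[of a b] that by (simp add: h_def)
  have sep: "separated w v D"
    unfolding separated_def
  proof (intro ballI impI)
    fix f g assume fg: "f \<in> D" "g \<in> D" "f \<noteq> g"
    then obtain a e b e' where "f = h (a, e)" "g = h (b, e')" by (auto simp: D_range)
    moreover from this have "\<not> (e = e' \<and> int m dvd a - b)" using h_cong[of a b e] fg(3) by auto
    ultimately show "inv_into UNIV f v \<noteq> inv_into UNIV g v \<and> f w \<noteq> g w"
      using h_sep[of a e b e'] by blast
  qed
  have inj: "inj_on h ({0..<int m} \<times> UNIV)"
  proof (rule inj_onI)
    fix p q assume pq: "p \<in> {0..<int m} \<times> UNIV" "q \<in> {0..<int m} \<times> (UNIV :: bool set)" "h p = h q"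
    obtain a e b e' where [simp]: "p = (a, e)" "q = (b, e')" by fastforce
    have "e = e' \<and> int m dvd a - b" using h_sep[of a e b e'] pq(3) by simp
    then show "p = q" using pq(1,2) by (auto simp: mod_eq_dvd_iff[symmetric])
  qed
  have bij: "bij_betw h ({0..<int m} \<times> UNIV) D" using inj D_image by (simp add: bij_betw_def)
  have card_D: "card D = 2 * m"
    using bij_betw_same_card[OF bij] by (simp add: card_cartesian_product)

  \<comment> \<open>Separated automorphisms have distinct preimages of \<open>v\<close>, and these
    lie in two orbits of at most \<open>m\<close> vertices each.\<close>
  have bound: "card Z \<le> card D" if Z: "Z \<subseteq> Aut G" "separated w v Z" for Z
  proof -
    have "inv_into UNIV f v \<in> orb rots v \<union> orb rots (x (\<alpha> - \<nu>))" if "f \<in> Z" for f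
    proof -
      have f: "f \<in> Aut G" using that Z(1) by blast
      show ?thesis
      proof (cases "f \<in> rotations G x")
        case True
        then show ?thesis using rotation_inv_in_orb v_eq by simp
      next
        case False
        then have refl: "f \<in> reflections G x" using Aut_dihedral[OF f] by blast
        then obtain \<beta> where \<beta>: "\<And>i. f (x i) = x (\<beta> - i)" by (auto simp: reflections_def)
        have "int \<delta> dvd \<beta> - \<alpha>" using reflections_dvd[OF f \<beta> \<pi>(1,2)] .
        then show ?thesis using reflection_inv[OF refl] by (simp add: v_eq \<beta> x_in_orb_iff)
      qed
    qed
    then have "card Z \<le> card (orb rots v \<union> orb rots (x (\<alpha> - \<nu>)))"
      using Z(2) by (intro card_inj_on_le[of "\<lambda>f. inv_into UNIV f v"] finite_UnI finite_orb)
        (auto simp: inj_on_def separated_def)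
    also have "\<dots> \<le> card (orb rots v) + card (orb rots (x (\<alpha> - \<nu>)))" by (rule card_Un_le)
    also have "\<dots> \<le> card D" using card_orb[of v] card_orb[of "x (\<alpha> - \<nu>)"] card_D by linarith
    finally show ?thesis .
  qed
  have "id = h (0, False)" by (simp add: h_def rot_0)
  then have "id \<in> D" unfolding D_range by (rule range_eqI)
  obtain X where X: "optimum_saturating G w v X" "X \<inter> Aut G = D"
    using optimum_saturating_exists[OF finite_verts B_U_eq_Aut D_Aut \<open>id \<in> D\<close> sep bound] by blast
  have "group (perm_group D) \<and> perm_group D \<cong> dihedral_group m"
  proof (rule perm_group_transfer[OF group_dihedral_group[OF m_pos]])
    show "bij_betw h (carrier (dihedral_group m)) D" using bij by (simp add: dihedral_group_def)
    show "h \<one>\<^bsub>dihedral_group m\<^esub> = id" by (simp add: dihedral_group_def h_def rot_0)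
    fix p q :: "int \<times> bool"
    obtain a e b e' where [simp]: "p = (a, e)" "q = (b, e')" by fastforce
    have 1: "\<pi> (rot b u) = rot (- b) (\<pi> u)" and 2: "\<pi> (\<pi> u) = u" for u
      using fun_cong[OF \<pi>_rot, of b u] fun_cong[OF \<pi>_\<pi>, of u] by simp_all
    \<comment> \<open>The difference \<open>a - b\<close> occurs when \<pi> stands to the left of
      \<open>rot b\<close> and inverts it on being moved past.\<close>
    have "rot (a - b) = rot a \<circ> rot (- b)" using rot_add[of a "- b"] by simp
    then show "h (p \<otimes>\<^bsub>dihedral_group m\<^esub> q) = h p \<circ> h q"
      using rot_add[of a b] by (cases e; cases e') (simp_all add: dihedral_group_def h_def rot_mod 1 2 fun_eq_iff)
  qed
  then have "optimum_saturating G w v X \<and> X \<inter> Aut G = rots \<union> {\<rho> \<circ> \<pi> | \<rho>. \<rho> \<in> rots} \<and>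
      group (perm_group (X \<inter> Aut G)) \<and> perm_group (X \<inter> Aut G) \<cong> dihedral_group m"
    unfolding X(2) D_def[symmetric] using X(1) by blast
  then show ?thesis using \<pi>_refl by blast
qed

end

section \<open>Assembly of the cyclic and the dihedral part\<close>

theorem theorem5p8:
  fixes U :: "'a sgraph" and T :: "'b sgraph" and n :: nat
    and Up :: "'c sgraph" and w v :: 'c
    and cw cv :: "nat sgraph \<Rightarrow> nat"
    and c :: nat and x :: "int \<Rightarrow> 'c" and l :: "int \<Rightarrow> nat \<Rightarrow> 'c" and \<nu> :: int
    and \<delta> :: nat and \<phi> :: "'c \<Rightarrow> 'c" and \<Phi> :: "('c \<Rightarrow> 'c) set"
    and case_i case_ii :: bool
  assumes U: "sunshine U" "order_of U = n"
    and T: "caterpillar T" "order_of T = n"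
    and b: "common_cards U T \<ge> 5"
    and Up: "sunshine_supercard U T n Up" "marked_by U T Up w v"
    and choice: "\<And>H. sunshine_supercard U T n H \<Longrightarrow> marked_by U T H (cw H) (cv H)"
    and largest: "\<And>H. sunshine_supercard U T n H \<Longrightarrow> chi H (cw H) (cv H) \<le> chi Up w v"
    and lab: "labelling Up w v c x l \<nu>"
    and nontrivial: "\<exists>\<rho> \<in> rotations Up x. \<rho> (x 0) \<noteq> x 0"
    and delta: "\<delta> = rot_step Up x"
    and phi: "label_rotation Up x l \<delta> \<phi>"
    and Phi: "\<Phi> = {\<phi> ^^ k | k. k < c div \<delta>}"
    and case_i: "case_i \<longleftrightarrow> {\<rho> (x \<nu>) | \<rho>. \<rho> \<in> reflections Up x} \<subseteq> orb \<Phi> (x \<nu>)"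
    and case_ii: "case_ii \<longleftrightarrow> degree Up (x 0) = 3 \<and>
                    {\<rho> (x 0) | \<rho>. \<rho> \<in> reflections Up x} \<subseteq> orb \<Phi> (x 0)"
  shows "(case_i \<or> case_ii \<longrightarrow>
            (\<exists>X. optimum_saturating Up w v X \<and> X \<inter> Aut Up = \<Phi> \<and>
                 group (perm_group (X \<inter> Aut Up)) \<and>
                 perm_group (X \<inter> Aut Up) \<cong> integer_mod_group (c div \<delta>))) \<and>
         (\<not> case_i \<and> \<not> case_ii \<longrightarrow>
            (\<exists>\<pi> \<in> reflections Up x. \<exists>X. optimum_saturating Up w v X \<and>
                 X \<inter> Aut Up = \<Phi> \<union> {\<rho> \<circ> \<pi> | \<rho>. \<rho> \<in> \<Phi>} \<and>
                 group (perm_group (X \<inter> Aut Up)) \<and>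
                 perm_group (X \<inter> Aut Up) \<cong> dihedral_group (c div \<delta>)))"
proof -
  interpret rotational_sunshine Up w v c x l \<nu> \<delta> \<phi>
  proof unfold_locales
    show "sunshine Up" using Up(1) by (simp add: sunshine_supercard_def)
    show "w \<in> verts Up" "degree Up w = 1" using Up(2) by (simp_all add: marked_by_def)
  qed (fact lab nontrivial delta phi)+
  have \<Phi>: "\<Phi> = rots" by (simp add: Phi rots_def)
  show ?thesis
  proof (intro conjI impI)
    assume "case_i \<or> case_ii"
    then have "\<exists>X. optimum_saturating Up w v X \<and> X \<inter> Aut Up = rots"
    proof
      assume case_i
      then show ?thesis unfolding case_i \<Phi> v_eq[symmetric] by (rule rots_optimum_case_i)
    next
      assume case_ii
      then show ?thesis unfolding case_ii \<Phi> by (elim conjE) (rule rots_optimum_case_ii)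
    qed
    then obtain X where "optimum_saturating Up w v X" "X \<inter> Aut Up = rots" by blast
    then show "\<exists>X. optimum_saturating Up w v X \<and> X \<inter> Aut Up = \<Phi> \<and>
        group (perm_group (X \<inter> Aut Up)) \<and> perm_group (X \<inter> Aut Up) \<cong> integer_mod_group (c div \<delta>)"
      unfolding \<Phi> using rots_group by metis
  next
    assume "\<not> case_i \<and> \<not> case_ii"
    then have "\<not> case_i" "\<not> case_ii" by simp_all
    then show "\<exists>\<pi> \<in> reflections Up x. \<exists>X. optimum_saturating Up w v X \<and>
        X \<inter> Aut Up = \<Phi> \<union> {\<rho> \<circ> \<pi> | \<rho>. \<rho> \<in> \<Phi>} \<and>
        group (perm_group (X \<inter> Aut Up)) \<and> perm_group (X \<inter> Aut Up) \<cong> dihedral_group (c div \<delta>)"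
      unfolding case_i case_ii \<Phi> v_eq[symmetric] by (rule dihedral_optimum)
  qed
qed

end
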